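(* Let $M\subset\mathbb{R}^2$ be an oval of length $L_M$, enclosing a region of area $A_M$. Then $$L_M^2\geqslant 4\pi A_M+8\pi\left|\widetilde{A}_{E_{1/2}(M)}\right|,$$ where $\widetilde{A}_{E_{1/2}(M)}$ is the oriented area of the Wigner caustic $E_{1/2}(M)$ of $M$. Moreover, equality holds if and only if $M$ is a curve of constant width.
   Context: An oval is a smooth ($C^\infty$) regular closed simple curve in $\mathbb{R}^2$ that is convex, i.e. its signed curvature has constant sign (in particular it is nowhere zero). Fix an origin $O$ inside the oval $M$ and orient $M$ positively. For $\theta\in\mathbb{R}$ let $p(\theta)$ be the Minkowski support function of $M$: the oriented distance from $O$ to the tangent line of $M$ whose outer normal is $(\cos\theta,\sin\theta)$. It is $2\pi$-periodic, and $M$ is parametrized by $$\gamma(\theta)=\big(p(\theta)\cos\theta-p'(\theta)\sin\theta,\ p(\theta)\sin\theta+p'(\theta)\cos\theta\big),$$ with radius of curvature $\rho(\theta)=p(\theta)+p''(\theta)>0$. A parallel pair of $M$ is a pair of distinct points $a,b\in M$ at which the tangent lines to $M$ are parallel. The Wigner caustic is $E_{1/2}(M)=\{\tfrac12 a+\tfrac12 b : a,b \text{ a parallel pair of } M\}$. It is parametrized by $\gamma_{1/2}(\theta)=\tfrac12\gamma(\theta)+\tfrac12\gamma(\theta+\pi)$. Since $\gamma_{1/2}(\theta+\pi)=\gamma_{1/2}(\theta)$, the interval $[0,2\pi]$ covers the Wigner caustic twice, and its oriented area is computed by traversing it once: $$\widetilde{A}_{E_{1/2}(M)}=\frac12\int_{0}^{\pi}\big(\gamma_{1/2,1}\,\gamma_{1/2,2}'-\gamma_{1/2,2}\,\gamma_{1/2,1}'\big)\,d\theta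 ,$$ where $\gamma_{1/2}=(\gamma_{1/2,1},\gamma_{1/2,2})$. An oval has constant width if the distance between every pair of (distinct) parallel tangent lines is the same, i.e. $p(\theta)+p(\theta+\pi)$ is constant. *)

theory Defs
  imports "HOL-Analysis.Analysis"
begin

abbreviation velocity :: "(real \<Rightarrow> real^2) \<Rightarrow> real \<Rightarrow> real^2" where
  "velocity g t \<equiv> vector_derivative g (at t)"

definition smooth_curve :: "(real \<Rightarrow> real^2) \<Rightarrow> bool" where
  "smooth_curve g \<longleftrightarrow> (\<forall>n t. (velocity ^^ n) g differentiable (at t))"

definition regular_curve :: "(real \<Rightarrow> real^2) \<Rightarrow> bool" where
  "regular_curve g \<longleftrightarrow> (\<forall>t. velocity g t \<noteq> 0)"

text \<open>A closed curve is given by a periodic map on the whole line, so that smoothness at the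
  base point is automatic; one turn is the parameter interval from \<open>0\<close> to \<open>T\<close>.\<close>

definition simple_closed_curve :: "(real \<Rightarrow> real^2) \<Rightarrow> real \<Rightarrow> bool" where
  "simple_closed_curve g T \<longleftrightarrow> T > 0 \<and> (\<forall>t. g (t + T) = g t) \<and> inj_on g {0..<T}"

definition signed_curvature :: "(real \<Rightarrow> real^2) \<Rightarrow> real \<Rightarrow> real" where
  "signed_curvature g t =
     (velocity g t $ 1 * velocity (velocity g) t $ 2 - velocity g t $ 2 * velocity (velocity g) t $ 1)
       / norm (velocity g t) ^ 3"

text \<open>Both orientations of the parametrization are admitted; the support function below depends
  only on the image of the curve.\<close>

definition oval :: "(real \<Rightarrow> real^2) \<Rightarrow> real \<Rightarrow> bool" where
  "oval g T \<longleftrightarrow> smooth_curve g \<and> regular_curve g \<and> simple_closed_curve g T \<and>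
     ((\<forall>t. signed_curvature g t > 0) \<or> (\<forall>t. signed_curvature g t < 0))"

definition curve_length :: "(real \<Rightarrow> real^2) \<Rightarrow> real \<Rightarrow> real" where
  "curve_length g T = integral {0..T} (\<lambda>t. norm (velocity g t))"

definition enclosed_area :: "(real \<Rightarrow> real^2) \<Rightarrow> real" where
  "enclosed_area g = measure lebesgue (inside (range g))"

definition tangent_line :: "(real \<Rightarrow> real^2) \<Rightarrow> real \<Rightarrow> (real^2) set" where
  "tangent_line g t = {g t + s *\<^sub>R velocity g t | s. True}"

definition parallel_tangents :: "(real \<Rightarrow> real^2) \<Rightarrow> real \<Rightarrow> real \<Rightarrow> bool" where
  "parallel_tangents g s t \<longleftrightarrow> (\<exists>k. velocity g t = k *\<^sub>R velocity g s)"

definition constant_width :: "(real \<Rightarrow> real^2) \<Rightarrow> bool" where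
  "constant_width g \<longleftrightarrow>
     (\<exists>w. \<forall>s t. parallel_tangents g s t \<and> tangent_line g s \<noteq> tangent_line g t
        \<longrightarrow> setdist (tangent_line g s) (tangent_line g t) = w)"

definition outer_normal :: "(real \<Rightarrow> real^2) \<Rightarrow> real \<Rightarrow> real^2 \<Rightarrow> bool" where
  "outer_normal g t n \<longleftrightarrow> norm n = 1 \<and> n \<bullet> velocity g t = 0 \<and>
     (\<forall>\<^sub>F s in at_right 0. g t + s *\<^sub>R n \<in> outside (range g))"

definition unit_vec :: "real \<Rightarrow> real^2" where
  "unit_vec \<theta> = vector [cos \<theta>, sin \<theta>]"

text \<open>The distance from the origin \<open>c\<close> to the tangent line with outer normal \<open>unit_vec \<theta>\<close>,
  oriented by that normal. On an oval exactly one point has this outer normal.\<close>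

definition support_fun :: "(real \<Rightarrow> real^2) \<Rightarrow> real^2 \<Rightarrow> real \<Rightarrow> real" where
  "support_fun g c \<theta> =
     (THE d. \<exists>t. outer_normal g t (unit_vec \<theta>) \<and> d = (g t - c) \<bullet> unit_vec \<theta>)"

text \<open>Coordinates of \<open>support_param\<close> are taken with respect to the origin \<open>c\<close>: the point of the
  oval with outer normal \<open>unit_vec \<theta>\<close> is \<open>c + support_param g c \<theta>\<close>.\<close>

definition support_param :: "(real \<Rightarrow> real^2) \<Rightarrow> real^2 \<Rightarrow> real \<Rightarrow> real^2" where
  "support_param g c \<theta> =
     (let p = support_fun g c in
      vector [p \<theta> * cos \<theta> - deriv p \<theta> * sin \<theta>, p \<theta> * sin \<theta> + deriv p \<theta> * cos \<theta>])"

text \<open>The midpoints of the parallel pairs of the oval, i.e. its Wigner caustic. This map has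
  period \<open>pi\<close>, so the oriented area is an integral over one turn, from \<open>0\<close> to \<open>pi\<close>.\<close>

definition wigner_caustic :: "(real \<Rightarrow> real^2) \<Rightarrow> real^2 \<Rightarrow> real \<Rightarrow> real^2" where
  "wigner_caustic g c \<theta> =
     (1/2) *\<^sub>R support_param g c \<theta> + (1/2) *\<^sub>R support_param g c (\<theta> + pi)"

definition wigner_oriented_area :: "(real \<Rightarrow> real^2) \<Rightarrow> real^2 \<Rightarrow> real" where
  "wigner_oriented_area g c =
     (let w = wigner_caustic g c in
      1/2 * integral {0..pi} (\<lambda>\<theta>. w \<theta> $ 1 * velocity w \<theta> $ 2 - w \<theta> $ 2 * velocity w \<theta> $ 1))"

end

theory Submission
  imports Defs
begin

text \<open>Let \<open>p\<close> be the support function of the oval, so that \<open>p + p''\<close> is its radius of curvature. Split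
\<open>p = e + q\<close> into the parts that are even and odd under the half turn
\<open>\<theta> \<mapsto> \<theta> + pi\<close>. Then \<open>2 * e\<close> is the width, and \<open>q\<close> is the support function of the Wigner caustic.
With integrals over a half period, the length is \<open>2 * integral e\<close>, the enclosed area is
\<open>integral (e\<^sup>2 - e'\<^sup>2) + integral (q\<^sup>2 - q'\<^sup>2)\<close>, and the oriented area of the caustic is half of
the second summand. Since \<open>q\<close> changes sign under the half turn, it vanishes at the ends of some
interval of length \<open>pi\<close>, so Wirtinger's inequality makes that summand nonpositive. The caustic term
therefore cancels the contribution of \<open>q\<close> exactly, and what remains is
\<open>(integral e)\<^sup>2 \<ge> pi * integral (e\<^sup>2 - e'\<^sup>2)\<close>. This is again Wirtinger's inequality, now
for \<open>e - e x\<close>, which vanishes at both ends of the period \<open>[x, x + pi]\<close>; the defect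
dominates the squared distance of \<open>e x\<close> from the mean of \<open>e\<close>, for every \<open>x\<close>. Hence equality holds
exactly when the width \<open>2 * e\<close> is constant. This is theorem \<open>isoperimetric_support\<close>.

The remaining work is to connect a simple closed curve of nonvanishing curvature with its support
function. Hopf's theorem on the rotation index (\<open>umlaufsatz\<close>) shows that the normal turns exactly
once, so that its angle is a global parameter (\<open>oval_by_normal_angle\<close>). In this parameter the
height of the curve in a fixed direction is monotone on either side of its maximum, so every tangent
line supports the curve (\<open>strictly_supported\<close>). The intersection \<open>body\<close> of the supporting
half-planes is then a convex body whose frontier is the curve; this identifies the inside and the
outside of the curve and its outer normals. The area of the body is found by a change of variables
to polar coordinates about the origin (\<open>measure_interior_body\<close>).\<close>

section \<open>Periodic functions\<close>

lemma periodic_int_multiple: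
  fixes f :: "real \<Rightarrow> 'a"
  assumes per: "\<And>t. f (t + T) = f t"
  shows "f (t + of_int n * T) = f t"
proof (induction n rule: int_induct[where k = 0])
  case (step1 i)
  then show ?case using per[of "t + of_int i * T"] by (simp add: algebra_simps)
next
  case (step2 i)
  then show ?case using per[of "t + of_int (i - 1) * T"] by (simp add: algebra_simps)
qed simp

lemma periodic_reduce:
  fixes f :: "real \<Rightarrow> 'a"
  assumes "T > 0" and per: "\<And>t. f (t + T) = f t"
  obtains s n where "a \<le> s" "s < a + T" "t = s + of_int n * T" "f s = f t"
proof -
  define n where "n = \<lfloor>(t - a) / T\<rfloor>"
  define s where "s = t - of_int n * T"
  have "a \<le> s" "s < a + T"
    using floor_divide_lower[OF \<open>T > 0\<close>, of "t - a"] floor_divide_upper[OF \<open>T > 0\<close>, of "t - a"]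
    by (auto simp: s_def n_def algebra_simps)
  moreover have "t = s + of_int n * T" by (simp add: s_def)
  ultimately show ?thesis using that[of s n] periodic_int_multiple[of f T, OF per, of s n] by simp
qed

lemma periodic_attains_min:
  fixes f :: "real \<Rightarrow> real"
  assumes "T > 0" and per: "\<And>t. f (t + T) = f t" and cont: "continuous_on UNIV f"
  obtains a where "\<And>t. f a \<le> f t"
proof -
  have "\<exists>a\<in>{0..T}. \<forall>t\<in>{0..T}. f a \<le> f t"
    by (rule continuous_attains_inf) (use \<open>T > 0\<close> continuous_on_subset[OF cont] in auto)
  then obtain a where a: "\<And>t. t \<in> {0..T} \<Longrightarrow> f a \<le> f t" by blast
  have "f a \<le> f t" for t
    using periodic_reduce[of T f 0 t, OF \<open>T > 0\<close> per] a by (metis add_0 atLeastAtMost_iff less_imp_le)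
  then show ?thesis using that by blast
qed

lemma periodic_vector_derivative:
  assumes per: "\<And>t. f (t + T) = f t"
    and deriv: "\<And>t. (f has_vector_derivative f' t) (at t)"
  shows "f' (t + T) = f' t"
proof -
  have "((\<lambda>r. r + T) has_vector_derivative 1) (at t)" by (auto intro!: derivative_eq_intros)
  from vector_diff_chain_at[OF this deriv]
  have "((\<lambda>t. f (t + T)) has_vector_derivative f' (t + T)) (at t)" by (simp add: o_def)
  then show ?thesis using per deriv vector_derivative_unique_at[of f "f' (t + T)" t "f' t"] by simp
qed

text \<open>The derivative of \<open>\<lambda>y. F (y + T) - F y\<close> vanishes for an antiderivative \<open>F\<close>. As \<open>F\<close> is only
an indefinite integral from a fixed left end, that end is placed to the left of both intervals.\<close>
lemma integral_periodic_shift: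
  fixes f :: "real \<Rightarrow> real"
  assumes cont: "continuous_on UNIV f" and per: "\<And>x. f (x + T) = f x" and "T > 0"
  shows "integral {a..a + T} f = integral {0..T} f"
proof -
  have int: "f integrable_on {x..y}" for x y
    using cont by (meson continuous_on_subset integrable_continuous_interval subset_UNIV)
  define F where "F y = integral {min 0 a - 1..y} f" for y
  have F': "(F has_real_derivative f y) (at y)" if "y > min 0 a - 1" for y
  proof -
    have "(F has_real_derivative f y) (at y within {min 0 a - 1..y + 1})"
      unfolding F_def by (rule integral_has_real_derivative) (use that continuous_on_subset[OF cont] in auto)
    then show ?thesis using that by (simp add: at_within_Icc_at)
  qed
  have F_diff: "integral {x..y} f = F y - F x" if "min 0 a - 1 \<le> x" "x \<le> y" for x y
    using Henstock_Kurzweil_Integration.integral_combine[OF that int] by (simp add: F_def)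
  have "((\<lambda>y. F (y + T) - F y) has_real_derivative 0) (at y)" if "y > min 0 a - 1" for y
  proof -
    have "((\<lambda>y. F (y + T)) has_real_derivative f (y + T)) (at y)"
      using F'[of "y + T"] that \<open>T > 0\<close> by (simp add: DERIV_shift)
    then show ?thesis using F'[OF that] per by (auto intro!: derivative_eq_intros)
  qed
  then have "\<exists>c. \<forall>y\<in>{min 0 a - 1<..}. F (y + T) - F y = c"
    by (intro has_field_derivative_zero_constant) (auto intro: has_field_derivative_at_within)
  then obtain k where k: "\<And>y. y > min 0 a - 1 \<Longrightarrow> F (y + T) - F y = k" by auto
  have "F (a + T) - F a = F (0 + T) - F 0" using k[of a] k[of 0] by linarith
  then show ?thesis using F_diff[of a "a + T"] F_diff[of 0 T] \<open>T > 0\<close> by simp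
qed

lemma integral_two_periods:
  fixes f :: "real \<Rightarrow> real"
  assumes cont: "continuous_on UNIV f" and "T \<ge> 0"
  shows "integral {0..2 * T} f = integral {0..T} (\<lambda>x. f x + f (x + T))"
proof -
  have int: "f integrable_on {x..y}" for x y
    using cont by (meson continuous_on_subset integrable_continuous_interval subset_UNIV)
  have c: "continuous_on {0..T} (\<lambda>x. f (x + T))"
    by (rule continuous_on_compose2[OF cont]) (auto intro!: continuous_intros)
  have "integral {0..2 * T} f = integral {0..T} f + integral {T..2 * T} f"
    using Henstock_Kurzweil_Integration.integral_combine[of 0 T "2 * T" f] int assms(2) by simp
  also have "integral {T..2 * T} f = integral {0..T} (\<lambda>x. f (x + T))"
    using integral_shift_Icc_real[of 0 T f T] by (simp add: o_def add.commute)
  also have "integral {0..T} f + integral {0..T} (\<lambda>x. f (x + T)) = integral {0..T} (\<lambda>x. f x + f (x + T))"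
    by (intro integral_add[symmetric] int integrable_continuous_interval c)
  finally show ?thesis .
qed

section \<open>The rotation index of a simple closed curve\<close>

text \<open>An angle whose sine stays nonnegative is confined to one interval of length \<open>pi\<close> between
consecutive zeros of the sine. Reversing the direction therefore means crossing that interval once,
and the sign of \<open>cos (\<alpha> a)\<close> tells from which end.\<close>
lemma half_turn_of_sin_nonneg:
  fixes \<alpha> :: "real \<Rightarrow> real"
  assumes "a \<le> b" and cont: "continuous_on {a..b} \<alpha>"
    and nonneg: "\<And>x. x \<in> {a..b} \<Longrightarrow> 0 \<le> sin (\<alpha> x)"
    and "sin (\<alpha> a) = 0" and opp: "cos (\<alpha> b) = - cos (\<alpha> a)"
  shows "\<alpha> b - \<alpha> a = pi * cos (\<alpha> a)"
proof -
  \<comment> \<open>A continuous angle that passes a value of negative sine contradicts the hypothesis.\<close>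
  have skip: False if "\<alpha> a \<le> y \<and> y \<le> \<alpha> b \<or> \<alpha> b \<le> y \<and> y \<le> \<alpha> a" "sin y < 0" for y
  proof -
    have "\<exists>x. a \<le> x \<and> x \<le> b \<and> \<alpha> x = y"
      using that(1) IVT'[of \<alpha> a y b] IVT2'[of \<alpha> b y a] \<open>a \<le> b\<close> cont by blast
    then show False using nonneg that(2) by force
  qed
  have "sin (\<alpha> a) ^ 2 + cos (\<alpha> a) ^ 2 = 1" by simp
  then have ca: "cos (\<alpha> a) = 1 \<or> cos (\<alpha> a) = -1" using assms(4) by (simp add: power2_eq_1_iff)
  have "sin (\<alpha> b) ^ 2 + cos (\<alpha> b) ^ 2 = 1" by simp
  then have sb: "sin (\<alpha> b) = 0" using ca opp by auto
  have c: "cos (\<alpha> b - \<alpha> a) = -1" using ca opp assms(4) sb by (auto simp: cos_diff)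
  have "cos (\<alpha> b - \<alpha> a - pi) = 1" using c by (simp add: cos_diff)
  then obtain j :: int where j: "\<alpha> b - \<alpha> a - pi = real_of_int j * 2 * pi"
    using cos_one_2pi_int by blast
  have jb: "\<alpha> b = \<alpha> a + pi + real_of_int j * 2 * pi" using j by simp
  have s: "sin (\<alpha> a + pi/2) = cos (\<alpha> a)" "sin (\<alpha> a - pi/2) = - cos (\<alpha> a)"
    "sin (\<alpha> a + 3*pi/2) = - cos (\<alpha> a)" "sin (\<alpha> a - 3*pi/2) = cos (\<alpha> a)"
  proof -
    have *: "cos (3*pi/2) = 0" "sin (3*pi/2) = -1"
      using cos_3over2_pi sin_3over2_pi by (simp_all add: field_simps)
    show "sin (\<alpha> a + pi/2) = cos (\<alpha> a)" "sin (\<alpha> a - pi/2) = - cos (\<alpha> a)"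
      by (simp_all add: sin_add sin_diff)
    show "sin (\<alpha> a + 3*pi/2) = - cos (\<alpha> a)" "sin (\<alpha> a - 3*pi/2) = cos (\<alpha> a)"
      using * by (simp_all add: sin_add sin_diff)
  qed
  have big: "real_of_int j * 2 * pi \<ge> 2 * pi" if "j \<ge> 1"
    using that mult_right_mono[of 1 "real_of_int j" "2*pi"] by simp
  have small: "real_of_int j * 2 * pi \<le> - (2 * pi)" if "j \<le> -1"
    using that mult_right_mono[of "real_of_int j" "-1" "2*pi"] by simp
  have small2: "real_of_int j * 2 * pi \<le> - (4 * pi)" if "j \<le> -2"
    using that mult_right_mono[of "real_of_int j" "-2" "2*pi"] by simp
  have big0: "real_of_int j * 2 * pi \<ge> 0" if "j \<ge> 0" using that by simp
  show ?thesis
  proof (cases "cos (\<alpha> a) = 1")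
    case True
    have "\<not> j \<ge> 1" using skip[of "\<alpha> a + 3*pi/2"] s True jb big pi_gt_zero by (smt (verit) field_sum_of_halves)
    moreover have "\<not> j \<le> -1" using skip[of "\<alpha> a - pi/2"] s True jb small pi_gt_zero by (smt (verit) field_sum_of_halves)
    ultimately have "j = 0" by linarith
    then show ?thesis using jb True by simp
  next
    case False
    then have F: "cos (\<alpha> a) = -1" using ca by simp
    have "\<not> j \<ge> 0" using skip[of "\<alpha> a + pi/2"] s F jb big0 pi_gt_zero by (smt (verit) field_sum_of_halves)
    moreover have "\<not> j \<le> -2" using skip[of "\<alpha> a - 3*pi/2"] s F jb small2 pi_gt_zero by (smt (verit) field_sum_of_halves)
    ultimately have "j = -1" by linarith
    then show ?thesis using jb F by simp
  qed
qed

text \<open>Hopf's argument. The direction of the chord from \<open>z s\<close> to \<open>z (s + h)\<close> extends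
continuously to the strip \<open>0 \<le> h \<le> T\<close>: it tends to the tangent direction as \<open>h\<close> tends to \<open>0\<close>, and to
its opposite as \<open>h\<close> tends to \<open>T\<close>. The strip is convex, so the direction has a continuous angle on it,
and the turning of the tangent over one period can be computed along any other path from
\<open>(t\<^sub>0, 0)\<close> to \<open>(t\<^sub>0 + T, 0)\<close>. Going through \<open>(t\<^sub>0, T)\<close> with \<open>z t\<^sub>0\<close> a lowest point of the curve, the
chord first points upwards and then downwards, so that each of the two legs contributes a half turn, both
with the same sign.\<close>
theorem umlaufsatz:
  fixes z z' :: "real \<Rightarrow> complex"
  assumes "T > 0" and per: "\<And>t. z (t + T) = z t" and inj: "inj_on z {0..<T}"
    and deriv: "\<And>t. (z has_vector_derivative z' t) (at t)"
    and cont: "continuous_on UNIV z'" and nz: "\<And>t. z' t \<noteq> 0"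
  obtains L :: "real \<Rightarrow> complex" and t\<^sub>0 where
    "continuous_on UNIV L" "\<And>t. z' t = exp (L t)"
    "\<bar>Im (L (t\<^sub>0 + T)) - Im (L t\<^sub>0)\<bar> = 2 * pi"
proof -
  \<comment> \<open>The difference quotient \<open>(z (s + h) - z s) / h\<close>, written so that it is continuous at \<open>h = 0\<close>.\<close>
  define D where "D s h = integral {0..1} (\<lambda>r. z' (s + r * h))" for s h :: real
  have contz: "continuous_on UNIV z"
    using deriv by (meson continuous_at_imp_continuous_on has_vector_derivative_continuous)
  have contD: "continuous_on UNIV (\<lambda>(s, h). D s h)"
  proof -
    have "continuous_on (UNIV \<times> cbox 0 1) (\<lambda>((s, h), r). z' (s + r * h))"
      unfolding case_prod_unfold
      by (rule continuous_on_compose2[OF cont]) (auto intro!: continuous_intros)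
    then have "continuous_on UNIV (\<lambda>p. integral (cbox 0 1) (\<lambda>r. z' (fst p + r * snd p)))"
      by (intro integral_continuous_on_param) (simp add: case_prod_unfold)
    then show ?thesis by (simp add: D_def case_prod_unfold)
  qed
  have D_mult: "h *\<^sub>R D s h = z (s + h) - z s" for s h
  proof -
    have "((\<lambda>r. z (s + r * h)) has_vector_derivative h *\<^sub>R z' (s + r * h)) (at r within {0..1})" for r
    proof -
      have "((\<lambda>r. s + r * h) has_vector_derivative h) (at r within {0..1})"
        by (auto intro!: derivative_eq_intros)
      from vector_diff_chain_within[OF this has_vector_derivative_at_within[OF deriv]]
      show ?thesis by (simp add: o_def)
    qed
    then have "((\<lambda>r. h *\<^sub>R z' (s + r * h)) has_integral (z (s + 1 * h) - z (s + 0 * h))) {0..1}"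
      by (intro fundamental_theorem_of_calculus) auto
    from integral_unique[OF this] show ?thesis by (simp add: D_def)
  qed
  note per' = periodic_vector_derivative[of z T z', OF per deriv]
  have D0: "D s 0 = z' s" for s by (simp add: D_def)
  have DmT: "D s (-T) = 0" "D s T = 0" for s
    using D_mult[of "-T" s] D_mult[of T s] per[of "s - T"] per[of s] \<open>T > 0\<close> by auto
  \<comment> \<open>By periodicity \<open>F s h\<close> is \<open>T / (h * (T - h))\<close> times the chord: a positive
    rescaling that removes the zeros of the chord at both edges of the strip.\<close>
  define F where "F s h = D s h - D s (h - T)" for s h
  have F0: "F s 0 = z' s" and FT: "F s T = - z' s" for s by (simp_all add: F_def D0 DmT)
  have F_mult: "(h * (T - h)) *\<^sub>R F s h = T *\<^sub>R (z (s + h) - z s)" for s h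
  proof -
    have e1: "(h - T) *\<^sub>R D s (h - T) = z (s + h) - z s" using D_mult[of "h-T" s] per[of "s+h-T"] by (simp add: add_diff_eq)
    have "(h * (T - h)) *\<^sub>R F s h = (T - h) *\<^sub>R (h *\<^sub>R D s h) + h *\<^sub>R ((h - T) *\<^sub>R D s (h - T))"
      by (simp add: F_def algebra_simps)
    also have "\<dots> = ((T - h) + h) *\<^sub>R (z (s + h) - z s)"
      by (simp only: e1 D_mult[of h] scaleR_add_left)
    finally show ?thesis by simp
  qed
  have chord: "z (s + h) \<noteq> z s" if "0 < h" "h < T" for s h
  proof
    assume eq: "z (s + h) = z s"
    obtain s' n where s': "0 \<le> s'" "s' < T" and sn: "s = s' + of_int n * T"
      by (rule periodic_reduce[of T z 0 s, OF \<open>T > 0\<close> per]) auto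
    note perZ = periodic_int_multiple[of z T, OF per]
    have "z s' = z s" "z (s' + h) = z (s + h)"
      using perZ[of s' n] perZ[of "s' + h" n] by (auto simp: sn algebra_simps)
    then have e: "z (s' + h) = z s'" using eq by simp
    show False
    proof (cases "s' + h < T")
      case True
      then have "s' + h = s'" using inj_onD[OF inj e] s' that by simp
      then show False using that by simp
    next
      case False
      have "z (s' + h - T) = z s'" using e per[of "s' + h - T"] by simp
      then have "s' + h - T = s'" using inj_onD[OF inj] False s' that by simp
      then show False using that by simp
    qed
  qed
  have F_nz: "F s h \<noteq> 0" if "0 \<le> h" "h \<le> T" for s h
  proof (cases "h = 0 \<or> h = T")
    case True then show ?thesis using F0 FT nz by auto
  next
    case False
    then show ?thesis using F_mult[of h s] chord[of h s] that \<open>T > 0\<close> by auto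
  qed
  have contF: "continuous_on (UNIV \<times> {0..T}) (\<lambda>(s, h). F s h)"
  proof -
    have "continuous_on (UNIV \<times> {0..T}) (\<lambda>p. (\<lambda>(s, h). D s h) (fst p, snd p - T))"
      by (rule continuous_on_compose2[OF contD]) (auto intro!: continuous_intros)
    moreover have "continuous_on (UNIV \<times> {0..T}) (\<lambda>(s, h). D s h)"
      using contD continuous_on_subset by blast
    ultimately show ?thesis unfolding F_def case_prod_unfold by (auto intro!: continuous_intros)
  qed
  have "contractible (UNIV \<times> {0..T} :: (real \<times> real) set)"
    by (intro convex_imp_contractible convex_Times) auto
  \<comment> \<open>The imaginary part of this logarithm is the continuous angle of the chord.\<close>
  from continuous_logarithm_on_contractible[OF contF this]
  obtain G where contG: "continuous_on (UNIV \<times> {0..T}) G"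
    and G: "\<And>p. p \<in> UNIV \<times> {0..T} \<Longrightarrow> (\<lambda>(s, h). F s h) p = exp (G p)"
    using F_nz by (metis (no_types, lifting) atLeastAtMost_iff mem_Sigma_iff case_prod_unfold surjective_pairing)
  have FG: "F s h = exp (G (s, h))" if "0 \<le> h" "h \<le> T" for s h using G[of "(s,h)"] that by auto
  have comp: "continuous_on A (\<lambda>x. G (u x, v x))" if "continuous_on A u" "continuous_on A v" "\<And>x. x \<in> A \<Longrightarrow> 0 \<le> v x \<and> v x \<le> T"
    for u v and A :: "real set"
    by (rule continuous_on_compose2[OF contG]) (use that in \<open>auto intro!: continuous_intros\<close>)
  define A where "A s h = Im (G (s, h))" for s h
  have sinA: "Im (F s h) = exp (Re (G (s,h))) * sin (A s h)"
   and cosA: "Re (F s h) = exp (Re (G (s,h))) * cos (A s h)" if "0 \<le> h" "h \<le> T" for s h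
    using FG[OF that] by (simp_all add: A_def Im_exp Re_exp)
  obtain t0 where low: "\<And>t. Im (z t0) \<le> Im (z t)"
  proof (rule periodic_attains_min[of T "\<lambda>t. Im (z t)"])
    show "continuous_on UNIV (\<lambda>t. Im (z t))" using contz by (intro continuous_intros)
  qed (use \<open>T > 0\<close> per in auto)
  have flat: "Im (z' t0) = 0"
  proof -
    have "((\<lambda>t. Im (z t)) has_real_derivative Im (z' t0)) (at t0)"
      using deriv[of t0] by (metis has_vector_derivative_complex_iff has_real_derivative_iff_has_vector_derivative)
    then show ?thesis by (rule DERIV_local_min[of _ _ _ 1]) (use low in auto)
  qed
  \<comment> \<open>\<open>e\<close> is \<open>1\<close> or \<open>-1\<close> according to the direction in which the lowest point is traversed.\<close>
  define e where "e = cos (A t0 0)"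
  have sin00: "sin (A t0 0) = 0" using sinA[of 0 t0] F0 flat \<open>T > 0\<close> by simp
  have up: "0 \<le> Im (F t0 h)" if "0 \<le> h" "h \<le> T" for h
  proof (cases "h = 0 \<or> h = T")
    case True then show ?thesis using F0 FT flat by auto
  next
    case False
    have "(h * (T - h)) * Im (F t0 h) = T * (Im (z (t0 + h)) - Im (z t0))"
      using arg_cong[OF F_mult[of h t0], of Im] by simp
    then have "0 \<le> (h * (T - h)) * Im (F t0 h)" using low[of "t0 + h"] \<open>T > 0\<close> by simp
    moreover have "0 < h * (T - h)" using False that by simp
    ultimately show ?thesis using zero_le_mult_iff[of "h * (T - h)" "Im (F t0 h)"] by linarith
  qed
  have down: "Im (F (t0 + r) (T - r)) \<le> 0" if "0 \<le> r" "r \<le> T" for r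
  proof (cases "r = 0 \<or> r = T")
    case True then show ?thesis using F0 FT flat per' by auto
  next
    case False
    have "((T - r) * r) * Im (F (t0 + r) (T - r)) = T * (Im (z t0) - Im (z (t0 + r)))"
      using arg_cong[OF F_mult[of "T - r" "t0 + r"], of Im] per[of t0] by (simp add: algebra_simps)
    then have "((T - r) * r) * Im (F (t0 + r) (T - r)) \<le> 0" using low[of "t0 + r"] \<open>T > 0\<close> by (simp add: mult_le_0_iff)
    moreover have "0 < (T - r) * r" using False that by simp
    ultimately show ?thesis using mult_le_0_iff[of "(T - r) * r" "Im (F (t0 + r) (T - r))"] by linarith
  qed
  have cos_scale: "exp (Re (G (s,h))) = cmod (F s h)" if "0 \<le> h" "h \<le> T" for s h
    using FG[OF that] by simp
  have nz0: "cmod (z' t0) > 0" using nz by simp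
  have cos0: "cmod (z' t0) * cos (A t0 0) = Re (z' t0)"
    using cosA[of 0 t0] cos_scale[of 0 t0] F0 \<open>T > 0\<close> by simp
  have cosT: "cmod (z' t0) * cos (A t0 T) = - Re (z' t0)"
    using cosA[of T t0] cos_scale[of T t0] FT \<open>T > 0\<close> by simp
  have cosTT: "cmod (z' t0) * cos (A (t0+T) 0) = Re (z' t0)"
    using cosA[of 0 "t0+T"] cos_scale[of 0 "t0+T"] F0 \<open>T > 0\<close> per' by simp
  have opp: "cos (A t0 T) = - e" "cos (A (t0 + T) 0) = e"
    using cos0 cosT cosTT nz0 unfolding e_def by (metis minus_mult_right mult_left_cancel order_less_irrefl)+
  \<comment> \<open>The chord from the lowest point to the others: it points upwards.\<close>
  have leg1: "A t0 T - A t0 0 = pi * e"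
    unfolding e_def
  proof (rule half_turn_of_sin_nonneg[of 0 T "A t0"])
    show "continuous_on {0..T} (A t0)" unfolding A_def by (intro continuous_intros comp) auto
    show "0 \<le> sin (A t0 x)" if "x \<in> {0..T}" for x
      using up[of x] sinA[of x t0] that by (simp add: zero_le_mult_iff)
  qed (use \<open>T > 0\<close> sin00 opp e_def in auto)
  \<comment> \<open>The chord from the others back to the lowest point: it points downwards, so the angle is
    shifted by \<open>pi\<close>.\<close>
  have leg2: "A (t0 + T) 0 - A t0 T = pi * e"
  proof -
    have "(A (t0 + T) (T - T) + pi) - (A (t0 + 0) (T - 0) + pi) = pi * cos (A (t0 + 0) (T - 0) + pi)"
    proof (rule half_turn_of_sin_nonneg[of 0 T "\<lambda>r. A (t0 + r) (T - r) + pi"])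
      show "continuous_on {0..T} (\<lambda>r. A (t0 + r) (T - r) + pi)"
        unfolding A_def by (intro continuous_intros comp) auto
      show "0 \<le> sin (A (t0 + x) (T - x) + pi)" if "x \<in> {0..T}" for x
        using down[of x] sinA[of "T - x" "t0 + x"] that by (simp add: mult_le_0_iff)
      show "sin (A (t0 + 0) (T - 0) + pi) = 0"
        using sinA[of T t0] FT flat \<open>T > 0\<close> by simp
    qed (use \<open>T > 0\<close> opp in auto)
    then show ?thesis using opp by simp
  qed
  have "\<bar>e\<bar> = 1" using sin00 unfolding e_def
    by (metis abs_1 power2_eq_iff sin_zero_abs_cos_one)
  show ?thesis
  proof (rule that[of "\<lambda>s. G (s, 0)" t0])
    show "continuous_on UNIV (\<lambda>s. G (s, 0))" by (intro comp continuous_intros) (use \<open>T > 0\<close> in auto)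
    show "z' t = exp (G (t, 0))" for t using FG[of 0 t] F0 \<open>T > 0\<close> by simp
    have "Im (G (t0 + T, 0)) - Im (G (t0, 0)) = 2 * pi * e" using leg1 leg2 by (simp add: A_def algebra_simps)
    then show "\<bar>Im (G (t0 + T, 0)) - Im (G (t0, 0))\<bar> = 2 * pi" using \<open>\<bar>e\<bar> = 1\<close> by (simp add: abs_mult)
  qed
qed

section \<open>Ovals parametrized by the angle of the outer normal\<close>

lemma unit_vec_nth [simp]: "unit_vec \<theta> $ 1 = cos \<theta>" "unit_vec \<theta> $ 2 = sin \<theta>"
  by (simp_all add: unit_vec_def)

lemma inner_real2: "(x :: real^2) \<bullet> y = x $ 1 * y $ 1 + x $ 2 * y $ 2"
  by (simp add: inner_vec_def sum_2)

lemma vec_eq_iff_2: "(x :: 'a^2) = y \<longleftrightarrow> x $ 1 = y $ 1 \<and> x $ 2 = y $ 2"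
  by (simp add: vec_eq_iff forall_2)

lemma inner_unit_vec: "unit_vec \<alpha> \<bullet> unit_vec \<beta> = cos (\<alpha> - \<beta>)"
  by (simp add: inner_real2 cos_diff)

lemma norm_unit_vec [simp]: "norm (unit_vec \<theta>) = 1"
  by (simp add: norm_eq_sqrt_inner inner_unit_vec)

lemma unit_vec_add_pi: "unit_vec (\<theta> + pi) = - unit_vec \<theta>"
  by (simp add: vec_eq_iff_2)

lemma unit_vec_add_2pi [simp]: "unit_vec (\<theta> + 2 * pi) = unit_vec \<theta>"
  by (simp add: vec_eq_iff_2)

lemma unit_vec_expansion:
  "x = (x \<bullet> unit_vec \<theta>) *\<^sub>R unit_vec \<theta> + (x \<bullet> unit_vec (\<theta> + pi/2)) *\<^sub>R unit_vec (\<theta> + pi/2)"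
proof -
  have *: "cos \<theta> * cos \<theta> + sin \<theta> * sin \<theta> = 1"
    using sin_cos_squared_add[of \<theta>] by (simp add: power2_eq_square)
  show ?thesis
    by (simp add: vec_eq_iff_2 inner_real2 cos_add sin_add) (intro conjI; use * in algebra)
qed

lemma has_vector_derivative_unit_vec:
  "(unit_vec has_vector_derivative unit_vec (\<theta> + pi/2)) (at \<theta>)"
proof -
  have u: "unit_vec = (\<lambda>\<theta>. cos \<theta> *\<^sub>R axis 1 1 + sin \<theta> *\<^sub>R axis 2 1)"
    by (rule ext) (simp add: vec_eq_iff_2 axis_def)
  show ?thesis unfolding u
    by (auto intro!: derivative_eq_intros simp: cos_add sin_add
        simp flip: has_real_derivative_iff_has_vector_derivative)
qed

lemma exists_angle:
  assumes "norm (n :: real^2) = 1"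
  obtains \<theta> where "n = unit_vec \<theta>"
proof -
  have "(n $ 1)\<^sup>2 + (n $ 2)\<^sup>2 = 1"
    using assms by (simp add: norm_eq_sqrt_inner inner_real2 power2_eq_square)
  then obtain t where "n $ 1 = cos t" "n $ 2 = sin t" by (rule sincos_total_2pi)
  then show ?thesis using that[of t] by (simp add: vec_eq_iff_2)
qed

text \<open>Near \<open>t\<close> a continuous logarithm differs from the principal one by a constant, once \<open>f\<close> is normalized
to have the value \<open>1\<close> at \<open>t\<close>.\<close>
lemma has_vector_derivative_log:
  fixes f L :: "real \<Rightarrow> complex"
  assumes "isCont L t" and exp: "\<And>s. f s = exp (L s)" and f': "(f has_vector_derivative f') (at t)"
  shows "(L has_vector_derivative f' / f t) (at t)"
proof -
  have nz: "f s \<noteq> 0" for s by (simp add: exp)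
  obtain d where d: "d > 0" "\<And>s. dist s t < d \<Longrightarrow> dist (L s) (L t) < pi"
    using \<open>isCont L t\<close> pi_gt_zero unfolding continuous_at_eps_delta by metis
  have Ln: "L t + Ln (f s / f t) = L s" if "dist s t < d" for s
  proof -
    have "\<bar>Im (L s - L t)\<bar> < pi" using abs_Im_le_cmod[of "L s - L t"] d(2)[OF that] by (simp add: dist_norm)
    then have "Ln (exp (L s - L t)) = L s - L t" by (intro Ln_exp) auto
    then show ?thesis by (simp add: exp exp_diff)
  qed
  have 1: "((\<lambda>s. f s / f t) has_vector_derivative f' / f t) (at t)"
    using has_vector_derivative_mult_right[OF f', of "1 / f t"] by simp
  have "(Ln has_field_derivative inverse 1) (at (f t / f t))"
    using nz has_field_derivative_Ln[of 1] by simp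
  from field_vector_diff_chain_at[OF 1 this]
  have "((\<lambda>s. L t + Ln (f s / f t)) has_vector_derivative f' / f t) (at t)"
    by (auto intro!: derivative_eq_intros simp: o_def)
  then show ?thesis
    by (rule has_vector_derivative_transform_within[OF _ d(1)]) (use Ln in auto)
qed

text \<open>A closed curve parametrized by the angle \<open>\<theta>\<close> of its outer normal \<open>unit_vec \<theta>\<close>; the
function \<open>\<rho>\<close> is the radius of curvature. Its positivity makes the curve simple and convex.\<close>
locale support_curve =
  fixes \<gamma> :: "real \<Rightarrow> real^2" and \<rho> :: "real \<Rightarrow> real"
  assumes deriv: "\<And>\<theta>. (\<gamma> has_vector_derivative \<rho> \<theta> *\<^sub>R unit_vec (\<theta> + pi/2)) (at \<theta>)"
    and rho_pos: "\<And>\<theta>. \<rho> \<theta> > 0"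
    and cont_rho: "continuous_on UNIV \<rho>"
    and periodic: "\<And>\<theta>. \<gamma> (\<theta> + 2 * pi) = \<gamma> \<theta>"

text \<open>Here \<open>\<nu> t\<close> is the angle of the outer normal at \<open>g t\<close>, and the sign \<open>\<sigma>\<close> records the
orientation of \<open>g\<close>.\<close>
locale normal_angle_curve = support_curve +
  fixes g :: "real \<Rightarrow> real^2" and T :: real and \<nu> \<nu>' :: "real \<Rightarrow> real" and \<sigma> :: real
  assumes T_pos: "T > 0" and sign: "\<sigma> = 1 \<or> \<sigma> = -1"
    and nu_deriv: "\<And>t. (\<nu> has_real_derivative \<nu>' t) (at t)"
    and nu'_sign: "\<And>t. \<sigma> * \<nu>' t > 0"
    and nu_turn: "\<And>t. \<nu> (t + T) = \<nu> t + \<sigma> * (2 * pi)"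
    and nu_surj: "surj \<nu>"
    and g_eq: "\<And>t. g t = \<gamma> (\<nu> t)"

text \<open>The tangent angle \<open>\<phi>\<close> has the derivative \<open>signed_curvature g t * norm (velocity g t)\<close>, which
never vanishes. It is therefore strictly monotone, and it is onto because it gains \<open>2 * pi\<close> in absolute
value over each period. Its inverse is continuously differentiable and serves as the new parameter.\<close>
theorem oval_by_normal_angle:
  assumes "oval g T"
  obtains \<gamma> \<rho> \<nu> \<nu>' \<sigma> where "normal_angle_curve \<gamma> \<rho> g T \<nu> \<nu>' \<sigma>"
proof -
  from assms have smooth: "smooth_curve g" and reg: "\<And>t. velocity g t \<noteq> 0"
    and T: "T > 0" and per: "\<And>t. g (t + T) = g t" and inj: "inj_on g {0..<T}"
    and curv: "(\<forall>t. signed_curvature g t > 0) \<or> (\<forall>t. signed_curvature g t < 0)"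
    by (auto simp: oval_def regular_curve_def simple_closed_curve_def)
  define g1 g2 where "g1 = velocity g" and "g2 = velocity g1"
  have d0: "g differentiable (at t)" and d1: "g1 differentiable (at t)" and d2: "g2 differentiable (at t)" for t
    using smooth[unfolded smooth_curve_def, rule_format, of 0] smooth[unfolded smooth_curve_def, rule_format, of 1]
     smooth[unfolded smooth_curve_def, rule_format, of 2] by (simp_all add: g1_def g2_def numeral_2_eq_2)
  have g': "(g has_vector_derivative g1 t) (at t)" and g1': "(g1 has_vector_derivative g2 t) (at t)" for t
    using d0 d1 by (simp_all add: vector_derivative_works[symmetric] g1_def g2_def)
  have per1: "g1 (t + T) = g1 t" for t by (rule periodic_vector_derivative[OF per g'])
  have per2: "g2 (t + T) = g2 t" for t by (rule periodic_vector_derivative[OF per1 g1'])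
  have cont1: "continuous_on UNIV g1" and cont2: "continuous_on UNIV g2"
    using d1 d2 by (auto intro!: continuous_at_imp_continuous_on differentiable_imp_continuous_within)
  define k where "k t = g1 t $ 1 * g2 t $ 2 - g1 t $ 2 * g2 t $ 1" for t
  have n1: "norm (g1 t) > 0" for t using reg by (simp add: g1_def)
  obtain \<sigma> :: real where s: "\<sigma> = 1 \<or> \<sigma> = -1" and k: "\<And>t. \<sigma> * k t > 0"
  proof -
    have *: "signed_curvature g t = k t / norm (g1 t) ^ 3" for t
      by (simp add: signed_curvature_def k_def g1_def g2_def)
    from curv show ?thesis
    proof
      assume "\<forall>t. signed_curvature g t > 0"
      then show ?thesis using that[of 1] n1 * by (simp add: zero_less_divide_iff)
    next
      assume "\<forall>t. signed_curvature g t < 0"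
      then show ?thesis using that[of "-1"] n1 * by (simp add: divide_less_0_iff)
    qed
  qed
  define z z1 z2 where "z t = Complex (g t $ 1) (g t $ 2)" and "z1 t = Complex (g1 t $ 1) (g1 t $ 2)"
    and "z2 t = Complex (g2 t $ 1) (g2 t $ 2)" for t
  have nthd: "((\<lambda>s. f s $ i) has_vector_derivative f' $ i) (at t)" if "(f has_vector_derivative f') (at t)"
    for f :: "real \<Rightarrow> real^2" and f' t i
    using bounded_linear.has_vector_derivative[OF bounded_linear_vec_nth that] .
  have z': "(z has_vector_derivative z1 t) (at t)" and z1': "(z1 has_vector_derivative z2 t) (at t)" for t
    using nthd[OF g'] nthd[OF g1']
    by (simp_all add: has_vector_derivative_complex_iff z_def z1_def z2_def has_real_derivative_iff_has_vector_derivative)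
  have norm_z1: "cmod (z1 t) = norm (g1 t)" for t
    by (simp add: z1_def cmod_def norm_eq_sqrt_inner inner_real2 power2_eq_square)
  have z1_nz: "z1 t \<noteq> 0" for t using n1[of t] norm_z1[of t] by auto
  have z_eq: "z s = z t \<longleftrightarrow> g s = g t" for s t by (simp add: z_def vec_eq_iff_2)
  obtain L t\<^sub>0 where L: "continuous_on UNIV L" "\<And>t. z1 t = exp (L t)"
    and turn: "\<bar>Im (L (t\<^sub>0 + T)) - Im (L t\<^sub>0)\<bar> = 2 * pi"
  proof (rule umlaufsatz[of T z z1])
    show "z (t + T) = z t" for t by (simp add: z_eq per)
    show "inj_on z {0..<T}" using inj by (simp add: inj_on_def z_eq)
    show "continuous_on UNIV z1" using z1'
      by (meson continuous_at_imp_continuous_on has_vector_derivative_continuous)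
  qed (use T z' z1_nz in auto)
  define \<phi> where "\<phi> t = Im (L t)" for t
  define \<nu>' where "\<nu>' t = k t / (norm (g1 t))\<^sup>2" for t
  have phi': "(\<phi> has_real_derivative \<nu>' t) (at t)" for t
  proof -
    have "isCont L t" using L(1) by (simp add: continuous_on_eq_continuous_at)
    from has_vector_derivative_log[OF this L(2) z1']
    have "(\<phi> has_real_derivative Im (z2 t / z1 t)) (at t)"
      by (simp add: has_vector_derivative_complex_iff \<phi>_def [abs_def] has_real_derivative_iff_has_vector_derivative)
    moreover have "Im (z2 t / z1 t) = \<nu>' t"
      by (simp add: Im_divide \<nu>'_def k_def z1_def z2_def norm_eq_sqrt_inner inner_real2 power2_eq_square algebra_simps)
    ultimately show ?thesis by simp
  qed
  have nu'_pos: "\<sigma> * \<nu>' t > 0" for t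
    using k[of t] n1[of t] by (simp add: \<nu>'_def)
  have mono: "\<sigma> * \<phi> a < \<sigma> * \<phi> b" if "a < b" for a b
  proof (rule DERIV_pos_imp_increasing[OF that])
    show "\<exists>y. ((\<lambda>t. \<sigma> * \<phi> t) has_real_derivative y) (at x) \<and> y > 0" for x
      using DERIV_cmult[OF phi'[of x], of \<sigma>] nu'_pos[of x] by blast
  qed
  have turn': "\<phi> (t + T) = \<phi> t + \<sigma> * (2 * pi)" for t
  proof -
    have "\<sigma> * \<phi> t\<^sub>0 < \<sigma> * \<phi> (t\<^sub>0 + T)" using mono T by simp
    then have "\<phi> (t\<^sub>0 + T) - \<phi> t\<^sub>0 = \<sigma> * (2 * pi)" using turn s by (auto simp: \<phi>_def)
    moreover have "\<phi> (t + T) - \<phi> t = \<phi> (t\<^sub>0 + T) - \<phi> t\<^sub>0"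
    proof (rule DERIV_isconst_all[where f = "\<lambda>t. \<phi> (t + T) - \<phi> t"], rule allI)
      fix x
      have "((\<lambda>t. \<phi> (t + T)) has_real_derivative \<nu>' (x + T)) (at x)"
        using phi'[of "x + T"] by (simp add: DERIV_shift[of \<phi> _ x T])
      moreover have "\<nu>' (x + T) = \<nu>' x" by (simp add: \<nu>'_def k_def per1 per2)
      ultimately show "((\<lambda>t. \<phi> (t + T) - \<phi> t) has_real_derivative 0) (at x)"
        using phi'[of x] by (auto intro!: derivative_eq_intros)
    qed
    ultimately show ?thesis by simp
  qed
  \<comment> \<open>The outer normal lies to the right of the tangent for a positively oriented curve, to the left otherwise.\<close>
  define \<nu> where "\<nu> t = \<phi> t - \<sigma> * (pi / 2)" for t
  have nu': "(\<nu> has_real_derivative \<nu>' t) (at t)" for t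
    unfolding \<nu>_def using phi' by (auto intro!: derivative_eq_intros)
  have nu_mono: "\<sigma> * \<nu> a < \<sigma> * \<nu> b" if "a < b" for a b
    using mono[OF that] by (simp add: \<nu>_def right_diff_distrib)
  have nu_turn: "\<nu> (t + T) = \<nu> t + \<sigma> * (2 * pi)" for t by (simp add: \<nu>_def turn')
  have nu_cont: "isCont \<nu> t" for t using nu' DERIV_isCont by blast
  have nu_turns: "\<sigma> * \<nu> (real n * T) = \<sigma> * \<nu> 0 + real n * (2 * pi)"
     "\<sigma> * \<nu> (- (real n * T)) = \<sigma> * \<nu> 0 - real n * (2 * pi)" for n
  proof (induction n)
    case (Suc n)
    case 1 show ?case using nu_turn[of "real n * T"] Suc(1) s by (auto simp: algebra_simps)
    case 2 show ?case using nu_turn[of "- (real (Suc n) * T)"] Suc(2) s by (auto simp: algebra_simps)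
  qed simp_all
  have "surj \<nu>"
    unfolding surj_def
  proof (rule allI)
    fix y
    obtain n where n: "\<bar>y - \<nu> 0\<bar> < real n * (2 * pi)" using reals_Archimedean3[of "2*pi"] pi_gt_zero by auto
    have "\<exists>x\<ge>- (real n * T). x \<le> real n * T \<and> \<sigma> * \<nu> x = \<sigma> * y"
    proof (rule IVT')
      show "\<sigma> * \<nu> (- (real n * T)) \<le> \<sigma> * y" "\<sigma> * y \<le> \<sigma> * \<nu> (real n * T)"
        unfolding nu_turns using n s by auto
      show "continuous_on {- (real n * T)..real n * T} (\<lambda>x. \<sigma> * \<nu> x)"
        using nu_cont by (auto intro!: continuous_intros continuous_at_imp_continuous_on)
    qed (use T in simp)
    then show "\<exists>x. y = \<nu> x" using s by auto
  qed
  have "inj \<nu>"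
    by (rule injI) (metis linorder_cases nu_mono order_less_irrefl)
  define \<tau> where "\<tau> = inv \<nu>"
  have nt: "\<nu> (\<tau> \<theta>) = \<theta>" and tn: "\<tau> (\<nu> t) = t" for \<theta> t
    using \<open>surj \<nu>\<close> \<open>inj \<nu>\<close> by (simp_all add: \<tau>_def surj_f_inv_f)
  have tau_cont: "isCont \<tau> \<theta>" for \<theta>
    using isCont_inverse_function[of 1 "\<tau> \<theta>" \<tau> \<nu>] nu_cont by (simp add: nt tn)
  have nu'_nz: "\<nu>' t \<noteq> 0" for t using nu'_pos[of t] by auto
  have tau': "(\<tau> has_real_derivative inverse (\<nu>' (\<tau> \<theta>))) (at \<theta>)" for \<theta>
    by (rule DERIV_inverse_function[of \<nu> _ _ _ "\<theta> - 1" "\<theta> + 1"]) (use nu' nu'_nz nt tau_cont in auto)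
  define \<gamma> \<rho> where "\<gamma> \<theta> = g (\<tau> \<theta>)" and "\<rho> \<theta> = norm (g1 (\<tau> \<theta>)) / \<bar>\<nu>' (\<tau> \<theta>)\<bar>" for \<theta>
  have tangent: "g1 t = norm (g1 t) *\<^sub>R \<sigma> *\<^sub>R unit_vec (\<nu> t + pi/2)" for t
  proof -
    have e: "norm (g1 t) = exp (Re (L t))" using L(2)[of t] norm_z1[of t] by simp
    have "g1 t $ 1 = Re (z1 t)" "g1 t $ 2 = Im (z1 t)" by (simp_all add: z1_def)
    moreover have "cos (\<phi> t) = \<sigma> * cos (\<nu> t + pi/2)" "sin (\<phi> t) = \<sigma> * sin (\<nu> t + pi/2)"
      using s by (auto simp: \<nu>_def cos_add sin_add cos_diff sin_diff)
    ultimately show ?thesis using L(2)[of t] by (simp add: e vec_eq_iff_2 Re_exp Im_exp \<phi>_def)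
  qed
  have sc: "support_curve \<gamma> \<rho>"
  proof
    fix \<theta>
    have "\<bar>\<nu>' t\<bar> = \<sigma> * \<nu>' t" for t using s nu'_pos[of t] by auto
    then have coeff: "inverse (\<nu>' t) * (norm (g1 t) * \<sigma>) = norm (g1 t) / \<bar>\<nu>' t\<bar>" for t
      using s nu'_nz[of t] by (auto simp: field_simps)
    have "(\<gamma> has_vector_derivative inverse (\<nu>' (\<tau> \<theta>)) *\<^sub>R g1 (\<tau> \<theta>)) (at \<theta>)"
      using vector_diff_chain_at[OF tau'[unfolded has_real_derivative_iff_has_vector_derivative] g']
      by (simp add: o_def \<gamma>_def[abs_def])
    then show "(\<gamma> has_vector_derivative \<rho> \<theta> *\<^sub>R unit_vec (\<theta> + pi/2)) (at \<theta>)"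
      using coeff[of "\<tau> \<theta>"] by (subst (asm) tangent) (simp add: nt \<rho>_def)
    show "\<rho> \<theta> > 0" using n1 nu'_nz by (simp add: \<rho>_def)
    show "continuous_on UNIV \<rho>"
    proof -
      have ct: "continuous_on UNIV \<tau>" using tau_cont by (auto intro!: continuous_at_imp_continuous_on)
      have c: "continuous_on UNIV (\<lambda>\<theta>. g1 (\<tau> \<theta>))" "continuous_on UNIV (\<lambda>\<theta>. g2 (\<tau> \<theta>))"
        using continuous_on_compose2[OF cont1 ct] continuous_on_compose2[OF cont2 ct] by auto
      have "continuous_on UNIV (\<lambda>\<theta>. k (\<tau> \<theta>))"
        unfolding k_def by (intro continuous_intros c)
      then have "continuous_on UNIV (\<lambda>\<theta>. \<nu>' (\<tau> \<theta>))"
        unfolding \<nu>'_def using n1 by (intro continuous_intros c) auto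
      then show ?thesis unfolding \<rho>_def using nu'_nz by (intro continuous_intros c) auto
    qed
    have "\<tau> (\<theta> + \<sigma> * (2 * pi)) = \<tau> \<theta> + T" for \<theta>
      using tn[of "\<tau> \<theta> + T"] by (simp add: nu_turn nt)
    then have "\<gamma> (\<theta> + \<sigma> * (2 * pi)) = \<gamma> \<theta>" for \<theta> by (simp add: \<gamma>_def per)
    from this[of \<theta>] this[of "\<theta> + 2 * pi"] show "\<gamma> (\<theta> + 2 * pi) = \<gamma> \<theta>" using s by auto
  qed
  have "normal_angle_curve \<gamma> \<rho> g T \<nu> \<nu>' \<sigma>"
    by (intro normal_angle_curve.intro normal_angle_curve_axioms.intro sc)
      (use T s nu' nu'_pos nu_turn \<open>surj \<nu>\<close> in \<open>auto simp: \<gamma>_def tn\<close>)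
  then show ?thesis by (rule that)
qed

section \<open>The convex region bounded by the curve\<close>

context support_curve
begin

text \<open>With the normal and the tangent direction for \<open>f\<close> this gives the first two derivatives of the support
function; with a constant \<open>f\<close> it gives the monotonicity of heights.\<close>
lemma inner_derivative:
  assumes "(f has_vector_derivative f') (at \<theta>)"
  shows "((\<lambda>\<theta>. (\<gamma> \<theta> - c) \<bullet> f \<theta>) has_real_derivative
          \<rho> \<theta> * (unit_vec (\<theta> + pi/2) \<bullet> f \<theta>) + (\<gamma> \<theta> - c) \<bullet> f') (at \<theta>)"
proof -
  have "((\<lambda>\<theta>. \<gamma> \<theta> - c) has_vector_derivative \<rho> \<theta> *\<^sub>R unit_vec (\<theta> + pi/2)) (at \<theta>)"
    using deriv by (auto intro!: derivative_eq_intros)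
  from bounded_bilinear.has_vector_derivative[OF bounded_bilinear_inner this assms]
  show ?thesis by (simp add: has_real_derivative_iff_has_vector_derivative add.commute)
qed

lemma rho_periodic: "\<rho> (\<theta> + 2 * pi) = \<rho> \<theta>"
proof -
  have u: "unit_vec (\<theta> + 2 * pi + pi/2) = unit_vec (\<theta> + pi/2)"
    using unit_vec_add_2pi[of "\<theta> + pi/2"] by (simp add: add_ac)
  show ?thesis
    using arg_cong[OF periodic_vector_derivative[OF periodic deriv, of \<theta>], of "\<lambda>x. x \<bullet> unit_vec (\<theta> + pi/2)"]
    by (simp add: inner_unit_vec u)
qed

lemma cont_gamma: "continuous_on A \<gamma>"
  using deriv by (meson continuous_at_imp_continuous_on has_vector_derivative_continuous)

lemma unit_vec_eq_imp:
  assumes "unit_vec \<theta> = unit_vec \<alpha>" shows "\<gamma> \<theta> = \<gamma> \<alpha>"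
proof -
  have "cos (\<theta> - \<alpha>) = 1" using assms by (metis inner_unit_vec cancel_comm_monoid_add_class.diff_cancel cos_zero)
  then obtain n :: int where "\<theta> = \<alpha> + of_int n * (2 * pi)"
    using cos_one_2pi_int by (metis add.commute diff_add_cancel mult.assoc)
  then show ?thesis using periodic_int_multiple[of \<gamma> "2 * pi", OF periodic] by simp
qed

text \<open>The height of \<open>\<gamma> x\<close> in direction \<open>unit_vec \<alpha>\<close> has the derivative \<open>- \<rho> x * sin (x - \<alpha>)\<close>.
Since \<open>\<rho>\<close> is positive, the height increases strictly on \<open>[\<alpha> - pi, \<alpha>]\<close> and decreases strictly on
\<open>[\<alpha>, \<alpha> + pi]\<close>.\<close>
theorem strictly_supported:
  assumes "unit_vec \<theta> \<noteq> unit_vec \<alpha>"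
  shows "\<gamma> \<theta> \<bullet> unit_vec \<alpha> < \<gamma> \<alpha> \<bullet> unit_vec \<alpha>"
proof -
  obtain \<theta>' n where t: "\<alpha> - pi \<le> \<theta>'" "\<theta>' < \<alpha> - pi + 2 * pi" "\<theta> = \<theta>' + of_int n * (2 * pi)"
    and g: "\<gamma> \<theta>' = \<gamma> \<theta>"
    by (rule periodic_reduce[of "2 * pi" \<gamma> "\<alpha> - pi" \<theta>, OF _ periodic]) auto
  have "unit_vec \<theta> = unit_vec \<theta>'"
    unfolding t(3) by (rule periodic_int_multiple) simp
  then have ne: "\<theta>' \<noteq> \<alpha>" using assms by auto
  define f where "f x = \<gamma> x \<bullet> unit_vec \<alpha>" for x
  have f': "(f has_real_derivative - (\<rho> x * sin (x - \<alpha>))) (at x)" for x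
  proof -
    have "x + pi/2 - \<alpha> = (x - \<alpha>) + pi/2" by simp
    then have "unit_vec (x + pi/2) \<bullet> unit_vec \<alpha> = - sin (x - \<alpha>)"
      by (simp only: inner_unit_vec cos_add) simp
    then show ?thesis
      using inner_derivative[of "\<lambda>_. unit_vec \<alpha>" 0 x 0] by (simp add: f_def[abs_def])
  qed
  have cf: "continuous_on A f" for A unfolding f_def by (intro continuous_intros cont_gamma)
  have "f \<theta>' < f \<alpha>"
  proof (cases "\<theta>' < \<alpha>")
    case True
    show ?thesis
    proof (rule DERIV_pos_imp_increasing_open[OF True _ cf])
      fix x assume "\<theta>' < x" "x < \<alpha>"
      then have "sin (\<alpha> - x) > 0" using t by (intro sin_gt_zero) auto
      then have "0 < \<rho> x * sin (\<alpha> - x)" using rho_pos by simp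
      then have "0 < - (\<rho> x * sin (x - \<alpha>))" using sin_minus[of "x - \<alpha>"] by simp
      then show "\<exists>y. (f has_real_derivative y) (at x) \<and> 0 < y" using f' by blast
    qed
  next
    case False
    then have lt: "\<alpha> < \<theta>'" using ne by simp
    show ?thesis
    proof (rule DERIV_neg_imp_decreasing_open[OF lt _ cf])
      fix x assume "\<alpha> < x" "x < \<theta>'"
      then have "sin (x - \<alpha>) > 0" using t by (intro sin_gt_zero) auto
      then have "- (\<rho> x * sin (x - \<alpha>)) < 0" using rho_pos by simp
      then show "\<exists>y. (f has_real_derivative y) (at x) \<and> y < 0" using f' by blast
    qed
  qed
  then show ?thesis by (simp add: f_def g)
qed

lemma supported: "\<gamma> \<theta> \<bullet> unit_vec \<alpha> \<le> \<gamma> \<alpha> \<bullet> unit_vec \<alpha>"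
  using strictly_supported[of \<theta> \<alpha>] unit_vec_eq_imp[of \<theta> \<alpha>] by fastforce

definition body :: "(real^2) set" where
  "body = {x. \<forall>\<alpha>. x \<bullet> unit_vec \<alpha> \<le> \<gamma> \<alpha> \<bullet> unit_vec \<alpha>}"

lemma body_Inter: "body = (\<Inter>\<alpha>. {x. unit_vec \<alpha> \<bullet> x \<le> \<gamma> \<alpha> \<bullet> unit_vec \<alpha>})"
  by (auto simp: body_def inner_commute)

lemma convex_body: "convex body"
  unfolding body_Inter by (intro convex_INT convex_halfspace_le)

lemma closed_body: "closed body"
  unfolding body_Inter by (intro closed_INT ballI closed_halfspace_le)

lemma gamma_in_body: "\<gamma> \<theta> \<in> body"
  by (simp add: body_def supported)

lemma cont_unit_vec: "continuous_on A unit_vec"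
  using has_vector_derivative_unit_vec
  by (meson continuous_at_imp_continuous_on has_vector_derivative_continuous)

lemma support_gap_min:
  obtains a where "\<And>\<alpha>. (\<gamma> a - x) \<bullet> unit_vec a \<le> (\<gamma> \<alpha> - x) \<bullet> unit_vec \<alpha>"
proof (rule periodic_attains_min[of "2 * pi" "\<lambda>\<alpha>. (\<gamma> \<alpha> - x) \<bullet> unit_vec \<alpha>"])
  show "continuous_on UNIV (\<lambda>\<alpha>. (\<gamma> \<alpha> - x) \<bullet> unit_vec \<alpha>)"
    by (intro continuous_intros cont_gamma cont_unit_vec)
qed (auto simp: periodic)

lemma bounded_body: "bounded body"
proof -
  have "bounded (\<gamma> ` {0..2*pi})"
    by (intro compact_imp_bounded compact_continuous_image cont_gamma) auto
  then obtain B where B: "\<And>\<theta>. \<theta> \<in> {0..2*pi} \<Longrightarrow> norm (\<gamma> \<theta>) \<le> B"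
    unfolding bounded_iff by blast
  have B': "norm (\<gamma> \<theta>) \<le> B" for \<theta>
    using periodic_reduce[of "2*pi" \<gamma> 0 \<theta>, OF _ periodic] B
    by (metis add_0 atLeastAtMost_iff less_imp_le mult_pos_pos pi_gt_zero zero_less_numeral)
  have "norm x \<le> B" if "x \<in> body" for x
  proof (cases "x = 0")
    case True
    then show ?thesis using B'[of 0] by (metis norm_ge_zero norm_zero order_trans)
  next
    case False
    then obtain \<alpha> where a: "(1 / norm x) *\<^sub>R x = unit_vec \<alpha>" using exists_angle[of "(1 / norm x) *\<^sub>R x"] by auto
    have "x \<bullet> unit_vec \<alpha> = norm x" using False
      by (simp flip: a) (simp add: dot_square_norm power2_eq_square)
    then have "norm x \<le> \<gamma> \<alpha> \<bullet> unit_vec \<alpha>" using that by (auto simp: body_def dest: spec[of _ \<alpha>])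
    also have "\<dots> \<le> norm (\<gamma> \<alpha>)" using norm_cauchy_schwarz[of "\<gamma> \<alpha>" "unit_vec \<alpha>"] by simp
    also have "\<dots> \<le> B" by (rule B')
    finally show ?thesis .
  qed
  then show ?thesis unfolding bounded_iff by blast
qed

text \<open>Conversely to the obvious inclusion, a point strictly inside all supporting half-planes has a positive
distance from their boundary lines, because the distance attains its minimum over the periodic parameter.\<close>
lemma interior_body: "interior body = {x. \<forall>\<alpha>. x \<bullet> unit_vec \<alpha> < \<gamma> \<alpha> \<bullet> unit_vec \<alpha>}"
proof (intro equalityI subsetI CollectI allI)
  fix x \<alpha> assume "x \<in> interior body"
  then obtain e where e: "e > 0" "cball x e \<subseteq> body" by (auto simp: mem_interior_cball)
  have "x + e *\<^sub>R unit_vec \<alpha> \<in> body" using e by (intro subsetD[OF e(2)]) (simp add: dist_norm)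
  then have "(x + e *\<^sub>R unit_vec \<alpha>) \<bullet> unit_vec \<alpha> \<le> \<gamma> \<alpha> \<bullet> unit_vec \<alpha>" by (simp add: body_def)
  then show "x \<bullet> unit_vec \<alpha> < \<gamma> \<alpha> \<bullet> unit_vec \<alpha>" using e(1) by (simp add: inner_add_left inner_unit_vec)
next
  fix x assume "x \<in> {x. \<forall>\<alpha>. x \<bullet> unit_vec \<alpha> < \<gamma> \<alpha> \<bullet> unit_vec \<alpha>}"
  moreover obtain a where a: "\<And>\<alpha>. (\<gamma> a - x) \<bullet> unit_vec a \<le> (\<gamma> \<alpha> - x) \<bullet> unit_vec \<alpha>"
    using support_gap_min[of x] by blast
  ultimately have pos: "(\<gamma> a - x) \<bullet> unit_vec a > 0" by (simp add: inner_diff_left)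
  have "ball x ((\<gamma> a - x) \<bullet> unit_vec a) \<subseteq> body"
  proof
    fix y assume y: "y \<in> ball x ((\<gamma> a - x) \<bullet> unit_vec a)"
    have "y \<bullet> unit_vec \<alpha> \<le> \<gamma> \<alpha> \<bullet> unit_vec \<alpha>" for \<alpha>
      using norm_cauchy_schwarz[of "y - x" "unit_vec \<alpha>"] y a[of \<alpha>]
      by (simp add: inner_diff_left dist_norm norm_minus_commute)
    then show "y \<in> body" by (simp add: body_def)
  qed
  then show "x \<in> interior body" using pos by (meson centre_in_ball interiorI open_ball)
qed

text \<open>If a point \<open>x\<close> of the body lies on the supporting line of angle \<open>a\<close>, then the function
\<open>\<lambda>\<alpha>. (\<gamma> \<alpha> - x) \<bullet> unit_vec \<alpha>\<close> attains its minimum \<open>0\<close> at \<open>a\<close>. Its value and its derivative there are the two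
coordinates of \<open>\<gamma> a - x\<close>, so \<open>x\<close> is the point \<open>\<gamma> a\<close>.\<close>
lemma frontier_body: "frontier body = range \<gamma>"
proof -
  have "\<gamma> \<theta> \<notin> interior body" for \<theta>
    unfolding interior_body by (auto intro!: exI[of _ \<theta>])
  moreover have "x \<in> range \<gamma>" if x: "x \<in> body" "x \<notin> interior body" for x
  proof -
    obtain a where a: "x \<bullet> unit_vec a \<ge> \<gamma> a \<bullet> unit_vec a" using x(2) by (auto simp: interior_body not_less)
    define f where "f \<alpha> = (\<gamma> \<alpha> - x) \<bullet> unit_vec \<alpha>" for \<alpha>
    have fa: "f a = 0" "f \<alpha> \<ge> 0" for \<alpha>
      using x(1) a by (auto simp: f_def body_def inner_diff_left intro: antisym)
    have "(f has_real_derivative (\<gamma> a - x) \<bullet> unit_vec (a + pi/2)) (at a)"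
      using inner_derivative[OF has_vector_derivative_unit_vec, where c = x]
      by (simp add: f_def[abs_def] inner_unit_vec)
    then have "(\<gamma> a - x) \<bullet> unit_vec (a + pi/2) = 0"
      by (rule DERIV_local_min[of _ _ _ 1]) (use fa in auto)
    then have "\<gamma> a - x = 0"
      using fa(1) unit_vec_expansion[of "\<gamma> a - x" a] by (simp add: f_def)
    then show ?thesis by (metis eq_iff_diff_eq_0 rangeI)
  qed
  ultimately show ?thesis
    using gamma_in_body closed_body by (auto simp: frontier_def)
qed

lemma inside_range: "inside (range \<gamma>) = interior body"
  using inside_frontier_eq_interior[OF bounded_body convex_body] by (simp add: frontier_body)

lemma outside_range: "outside (range \<gamma>) = - body"
  using outside_frontier_eq_complement_closure[OF bounded_body convex_body] closed_body
  by (simp add: frontier_body)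

text \<open>Only \<open>unit_vec \<theta>\<close> and its opposite are normal at \<open>\<gamma> \<theta>\<close>. The ray in the first direction leaves the
supporting half-plane at once. The ray in the opposite direction meets the chord between the points of angle
\<open>\<theta> - pi/2\<close> and \<open>\<theta> + pi/2\<close>, which lie on different sides of the normal line; by convexity its
initial segment stays in the body.\<close>
theorem outward_iff:
  assumes "norm n = 1" "n \<bullet> unit_vec (\<theta> + pi/2) = 0"
  shows "(\<forall>\<^sub>F s in at_right 0. \<gamma> \<theta> + s *\<^sub>R n \<in> outside (range \<gamma>)) \<longleftrightarrow> n = unit_vec \<theta>"
proof
  assume "n = unit_vec \<theta>"
  moreover have "\<gamma> \<theta> + s *\<^sub>R unit_vec \<theta> \<notin> body" if "s > 0" for s
    using that by (auto simp: body_def inner_add_left inner_unit_vec not_le intro!: exI[of _ \<theta>])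
  ultimately show "\<forall>\<^sub>F s in at_right 0. \<gamma> \<theta> + s *\<^sub>R n \<in> outside (range \<gamma>)"
    by (auto simp: outside_range eventually_at_filter)
next
  assume out: "\<forall>\<^sub>F s in at_right 0. \<gamma> \<theta> + s *\<^sub>R n \<in> outside (range \<gamma>)"
  let ?a = "n \<bullet> unit_vec \<theta>"
  have n: "n = ?a *\<^sub>R unit_vec \<theta>" using unit_vec_expansion[of n \<theta>] assms(2) by simp
  have "\<bar>?a\<bar> = 1" using arg_cong[OF n, of norm] assms(1) by simp
  moreover have "?a \<noteq> -1"
  proof
    assume a: "?a = -1"
    let ?u = "unit_vec (\<theta> + pi/2)"
    define v w where "v = \<gamma> (\<theta> + pi/2) - \<gamma> \<theta>" and "w = \<gamma> (\<theta> - pi/2) - \<gamma> \<theta>"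
    have m: "unit_vec (\<theta> - pi/2) = - ?u" by (simp add: vec_eq_iff_2 cos_add sin_add cos_diff sin_diff)
    have ne: "unit_vec \<theta> \<noteq> unit_vec \<alpha>" if "cos (\<theta> - \<alpha>) \<noteq> 1" for \<alpha>
      using that by (metis inner_unit_vec cancel_comm_monoid_add_class.diff_cancel cos_zero)
    have v: "v \<bullet> ?u > 0" using strictly_supported[of \<theta> "\<theta> + pi/2"] ne[of "\<theta> + pi/2"]
      by (simp add: v_def inner_diff_left)
    have w: "w \<bullet> ?u < 0" using strictly_supported[of \<theta> "\<theta> - pi/2"] ne[of "\<theta> - pi/2"]
      by (simp add: w_def m inner_diff_left)
    have v0: "v \<bullet> unit_vec \<theta> < 0" using strictly_supported[of "\<theta> + pi/2" \<theta>] ne[of "\<theta> + pi/2"]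
      by (simp add: v_def inner_diff_left)
    have w0: "w \<bullet> unit_vec \<theta> < 0" using strictly_supported[of "\<theta> - pi/2" \<theta>] ne[of "\<theta> - pi/2"]
      by (simp add: w_def inner_diff_left)
    \<comment> \<open>The weight for which the convex combination of \<open>v\<close> and \<open>w\<close> lies on the normal line.\<close>
    define l where "l = - (w \<bullet> ?u) / (v \<bullet> ?u - w \<bullet> ?u)"
    have l: "0 < l" "l < 1" using v w by (simp_all add: l_def field_simps)
    define d where "d = - (l * (v \<bullet> unit_vec \<theta>) + (1 - l) * (w \<bullet> unit_vec \<theta>))"
    have d: "d > 0" using l v0 w0 unfolding d_def
      by (smt (verit, best) mult_pos_neg)
    have "(l *\<^sub>R v + (1 - l) *\<^sub>R w) \<bullet> ?u = 0"
    proof -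
      have "l * (v \<bullet> ?u - w \<bullet> ?u) = - (w \<bullet> ?u)" using v w by (simp add: l_def)
      then show ?thesis by (simp add: inner_add_left algebra_simps)
    qed
    then have "l *\<^sub>R v + (1 - l) *\<^sub>R w = (- d) *\<^sub>R unit_vec \<theta>"
      using unit_vec_expansion[of "l *\<^sub>R v + (1 - l) *\<^sub>R w" \<theta>]
      by (simp add: d_def inner_add_left)
    moreover have "l *\<^sub>R \<gamma> (\<theta> + pi/2) + (1 - l) *\<^sub>R \<gamma> (\<theta> - pi/2) \<in> body"
      using convexD[OF convex_body gamma_in_body gamma_in_body] l by simp
    moreover have "l *\<^sub>R \<gamma> (\<theta> + pi/2) + (1 - l) *\<^sub>R \<gamma> (\<theta> - pi/2) = \<gamma> \<theta> + (l *\<^sub>R v + (1 - l) *\<^sub>R w)"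
      by (simp add: v_def w_def algebra_simps)
    ultimately have far: "\<gamma> \<theta> - d *\<^sub>R unit_vec \<theta> \<in> body" by simp
    have near: "\<gamma> \<theta> - s *\<^sub>R unit_vec \<theta> \<in> body" if "0 < s" "s < d" for s
    proof -
      have "(1 - s/d) *\<^sub>R \<gamma> \<theta> + (s/d) *\<^sub>R (\<gamma> \<theta> - d *\<^sub>R unit_vec \<theta>) \<in> body"
        using that by (intro convexD[OF convex_body gamma_in_body far]) auto
      then show ?thesis using that by (simp add: algebra_simps)
    qed
    have "\<forall>\<^sub>F s in at_right 0. s < d" using d by (auto simp: eventually_at_right_field)
    moreover have "\<forall>\<^sub>F s in at_right (0::real). 0 < s" by (simp add: eventually_at_right_less)
    ultimately have "\<forall>\<^sub>F s in at_right (0::real). False"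
      using out
    proof eventually_elim
      case (elim s)
      have "\<gamma> \<theta> + s *\<^sub>R n = \<gamma> \<theta> - s *\<^sub>R unit_vec \<theta>" using n a by simp
      then show ?case using elim near[of s] by (simp add: outside_range)
    qed
    then show False by simp
  qed
  ultimately have "?a = 1" by linarith
  then show "n = unit_vec \<theta>" using n by simp
qed

end

section \<open>The enclosed area\<close>

lemma measure_open_rectangle:
  fixes a b :: "real^2"
  assumes "a $ 1 < b $ 1" "a $ 2 < b $ 2"
  shows "box a b \<in> lmeasurable" "measure lebesgue (box a b) = (b $ 1 - a $ 1) * (b $ 2 - a $ 2)"
proof -
  show "box a b \<in> lmeasurable" by simp
  have "cbox a b \<noteq> {}" using assms by (auto simp: interval_ne_empty_cart forall_2)
  then have "measure lborel (cbox a b) = (b $ 1 - a $ 1) * (b $ 2 - a $ 2)"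
    by (simp add: content_cbox_cart UNIV_2)
  then show "measure lebesgue (box a b) = (b $ 1 - a $ 1) * (b $ 2 - a $ 2)"
    by (simp add: measure_lborel_box_eq measure_lborel_cbox_eq)
qed

context support_curve
begin

definition support :: "real^2 \<Rightarrow> real \<Rightarrow> real" where
  "support c \<theta> = (\<gamma> \<theta> - c) \<bullet> unit_vec \<theta>"

lemma support_pos: "c \<in> interior body \<Longrightarrow> support c \<theta> > 0"
  by (simp add: interior_body support_def inner_diff_left)

lemma cont_support: "continuous_on A (support c)"
  unfolding support_def by (intro continuous_intros cont_gamma cont_unit_vec)

lemma interior_body_polar:
  assumes c: "c \<in> interior body" and x: "x \<in> interior body" "x \<noteq> c"
  obtains r \<theta> where "0 < r" "r < 1" "0 \<le> \<theta>" "\<theta> < 2 * pi" "x = c + r *\<^sub>R (\<gamma> \<theta> - c)"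
proof -
  obtain d where d: "d > 0" "c + d *\<^sub>R (x - c) \<in> frontier body"
    using ray_to_frontier[OF bounded_body c, of "x - c"] x(2) by auto
  then obtain \<theta> where t: "\<gamma> \<theta> = c + d *\<^sub>R (x - c)" by (auto simp: frontier_body)
  have "support c \<theta> = d * ((x - c) \<bullet> unit_vec \<theta>)" by (simp add: support_def t)
  moreover have "(x - c) \<bullet> unit_vec \<theta> < support c \<theta>"
    using x(1) by (simp add: interior_body support_def inner_diff_left)
  ultimately have "support c \<theta> < d * support c \<theta>" using d(1) by (metis mult_strict_left_mono)
  then have "d > 1" using support_pos[OF c, of \<theta>] by (simp add: mult_less_cancel_right1)
  moreover have "x = c + (1/d) *\<^sub>R (\<gamma> \<theta> - c)" using d(1) by (simp add: t)
  moreover obtain \<theta>' n where "0 \<le> \<theta>'" "\<theta>' < 0 + 2 * pi" "\<theta> = \<theta>' + of_int n * (2 * pi)" "\<gamma> \<theta>' = \<gamma> \<theta>"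
    by (rule periodic_reduce[of "2 * pi" \<gamma> 0 \<theta>, OF _ periodic]) auto
  ultimately show ?thesis using that[of "1/d" \<theta>'] by auto
qed

text \<open>Polar coordinates about \<open>c\<close>: the map \<open>(a, \<theta>) \<mapsto> c + sqrt a *\<^sub>R (\<gamma> \<theta> - c)\<close> on
the rectangle \<open>(0, 1) \<times> (0, 2 * pi)\<close> covers the body up to a null set. Taking \<open>sqrt a\<close>
as the radius makes its Jacobian \<open>support c \<theta> * \<rho> \<theta> / 2\<close> independent of \<open>a\<close>. The integral of this function over
the rectangle follows from a second change of variables: the map \<open>(a, \<theta>) \<mapsto> (a, \<sigma> \<theta>)\<close>, where
\<open>\<sigma>\<close> is an antiderivative of \<open>support c \<theta> * \<rho> \<theta>\<close>, has twice this Jacobian, and its image is a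
rectangle of area \<open>\<sigma> (2 * pi)\<close>.\<close>
theorem measure_interior_body:
  assumes c: "c \<in> interior body"
  shows "measure lebesgue (interior body) = integral {0..2 * pi} (\<lambda>\<theta>. support c \<theta> * \<rho> \<theta>) / 2"
proof -
  define j where "j \<theta> = support c \<theta> * \<rho> \<theta>" for \<theta>
  have j_pos: "j \<theta> > 0" for \<theta> using support_pos[OF c] rho_pos by (simp add: j_def)
  have j_cont: "continuous_on A j" for A
    unfolding j_def by (intro continuous_intros cont_support continuous_on_subset[OF cont_rho]) auto
  define \<sigma> where "\<sigma> \<theta> = integral {0..\<theta>} j" for \<theta>
  have \<sigma>_deriv: "(\<sigma> has_real_derivative j \<theta>) (at \<theta>)" if "0 < \<theta>" "\<theta> < 2 * pi" for \<theta>
  proof -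
    have "(\<sigma> has_real_derivative j \<theta>) (at \<theta> within {0..2 * pi})"
      unfolding \<sigma>_def by (rule integral_has_real_derivative) (use that j_cont in auto)
    then show ?thesis using that by (simp add: at_within_Icc_at)
  qed
  have \<sigma>_cont: "continuous_on {0..2 * pi} \<sigma>"
    unfolding \<sigma>_def by (intro indefinite_integral_continuous_1 integrable_continuous_interval j_cont)
  have \<sigma>_mono: "\<sigma> a < \<sigma> b" if "0 \<le> a" "a < b" "b \<le> 2 * pi" for a b
  proof (rule DERIV_pos_imp_increasing_open[OF \<open>a < b\<close>])
    show "\<exists>y. (\<sigma> has_real_derivative y) (at x) \<and> 0 < y" if "a < x" "x < b" for x
      using \<sigma>_deriv[of x] j_pos[of x] that \<open>0 \<le> a\<close> \<open>b \<le> 2 * pi\<close> by force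
    show "continuous_on {a..b} \<sigma>" by (rule continuous_on_subset[OF \<sigma>_cont]) (use that in auto)
  qed
  have \<sigma>0: "\<sigma> 0 = 0" by (simp add: \<sigma>_def)
  define S :: "(real^2) set" where "S = box 0 (vector [1, 2 * pi])"
  have S: "x \<in> S \<longleftrightarrow> 0 < x $ 1 \<and> x $ 1 < 1 \<and> 0 < x $ 2 \<and> x $ 2 < 2 * pi" for x
    by (auto simp: S_def mem_box_cart forall_2)
  have S_meas: "S \<in> sets lebesgue" by (simp add: S_def)
  have nth: "((\<lambda>x. x $ i) has_derivative (\<lambda>v. v $ i)) (at x within S)" for i and x :: "real^2"
    by (rule bounded_linear.has_derivative[OF bounded_linear_vec_nth has_derivative_ident])

  have "((\<lambda>x. \<bar>j (x $ 2)\<bar>) has_integral \<sigma> (2 * pi)) S"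
  proof -
    define f :: "real^2 \<Rightarrow> real^2" where "f x = x $ 1 *\<^sub>R axis 1 1 + \<sigma> (x $ 2) *\<^sub>R axis 2 1" for x
    define f' :: "real^2 \<Rightarrow> real^2 \<Rightarrow> real^2"
      where "f' x v = v $ 1 *\<^sub>R axis 1 1 + (v $ 2 * j (x $ 2)) *\<^sub>R axis 2 1" for x v
    have f_nth: "f x $ 1 = x $ 1" "f x $ 2 = \<sigma> (x $ 2)" for x by (simp_all add: f_def axis_def)
    have "(f has_derivative f' x) (at x within S)" if "x \<in> S" for x
      unfolding f_def f'_def
      by (intro has_derivative_add has_derivative_scaleR_left nth DERIV_compose_FDERIV \<sigma>_deriv)
        (use that S in auto)
    moreover have "inj_on f S"
    proof (rule inj_onI)
      fix x y assume "x \<in> S" "y \<in> S" "f x = f y"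
      then have "x $ 1 = y $ 1" "\<sigma> (x $ 2) = \<sigma> (y $ 2)" by (metis f_nth)+
      moreover from this(2) have "x $ 2 = y $ 2"
        using \<sigma>_mono[of "x $ 2" "y $ 2"] \<sigma>_mono[of "y $ 2" "x $ 2"] \<open>x \<in> S\<close> \<open>y \<in> S\<close> S by force
      ultimately show "x = y" by (simp add: vec_eq_iff_2)
    qed
    moreover have image: "f ` S = box 0 (vector [1, \<sigma> (2 * pi)])"
    proof (intro equalityI subsetI)
      fix y assume "y \<in> f ` S"
      then show "y \<in> box 0 (vector [1, \<sigma> (2 * pi)])"
        using \<sigma>_mono[of 0] \<sigma>_mono[of _ "2 * pi"] by (auto simp: S mem_box_cart forall_2 f_nth \<sigma>0)
    next
      fix y :: "real^2" assume "y \<in> box 0 (vector [1, \<sigma> (2 * pi)])"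
      then have y: "0 < y $ 1" "y $ 1 < 1" "0 < y $ 2" "y $ 2 < \<sigma> (2 * pi)"
        by (auto simp: mem_box_cart forall_2)
      then obtain \<theta> where t: "0 \<le> \<theta>" "\<theta> \<le> 2 * pi" "\<sigma> \<theta> = y $ 2"
        using IVT'[of \<sigma> 0 "y $ 2" "2 * pi"] \<sigma>_cont \<sigma>0 by auto
      then have "\<theta> \<noteq> 0" "\<theta> \<noteq> 2 * pi" using y \<sigma>0 by auto
      then have "vector [y $ 1, \<theta>] \<in> S" "f (vector [y $ 1, \<theta>]) = y"
        using t y by (auto simp: S vec_eq_iff_2 f_nth)
      then show "y \<in> f ` S" by (metis image_eqI)
    qed
    moreover have "\<bar>det (matrix (f' x))\<bar> = \<bar>j (x $ 2)\<bar>" for x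
      by (simp add: det_2 matrix_def f'_def axis_def)
    moreover have "f ` S \<in> lmeasurable \<and> measure lebesgue (f ` S) = \<sigma> (2 * pi)"
      using measure_open_rectangle[of 0 "vector [1, \<sigma> (2 * pi)]"] \<sigma>_mono[of 0 "2 * pi"] unfolding image
      by (simp add: \<sigma>0)
    ultimately show ?thesis using has_measure_differentiable_image[OF S_meas, of f f' "\<sigma> (2 * pi)"] by simp
  qed
  then have half: "((\<lambda>x. \<bar>j (x $ 2) / 2\<bar>) has_integral \<sigma> (2 * pi) / 2) S"
    by (simp add: has_integral_divide)

  define P where "P x = c + sqrt (x $ 1) *\<^sub>R (\<gamma> (x $ 2) - c)" for x :: "real^2"
  define P' where "P' x v = sqrt (x $ 1) *\<^sub>R (v $ 2) *\<^sub>R \<rho> (x $ 2) *\<^sub>R unit_vec (x $ 2 + pi/2)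
       + (v $ 1 * (inverse (sqrt (x $ 1)) / 2)) *\<^sub>R (\<gamma> (x $ 2) - c)" for x v :: "real^2"
  have P_deriv: "(P has_derivative P' x) (at x within S)" if "x \<in> S" for x
  proof -
    have "((\<lambda>x. \<gamma> (x $ 2)) has_derivative (\<lambda>v. (v $ 2) *\<^sub>R \<rho> (x $ 2) *\<^sub>R unit_vec (x $ 2 + pi/2))) (at x within S)"
      using has_derivative_compose[OF nth[of 2 x] deriv[of "x $ 2", unfolded has_vector_derivative_def]] .
    then have 1: "((\<lambda>x. \<gamma> (x $ 2) - c) has_derivative (\<lambda>v. (v $ 2) *\<^sub>R \<rho> (x $ 2) *\<^sub>R unit_vec (x $ 2 + pi/2))) (at x within S)"
      by (auto intro!: derivative_eq_intros)
    have 2: "((\<lambda>x. sqrt (x $ 1)) has_derivative (\<lambda>v. v $ 1 * (inverse (sqrt (x $ 1)) / 2))) (at x within S)"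
      by (intro DERIV_compose_FDERIV nth DERIV_real_sqrt) (use that S in auto)
    from has_derivative_add[OF has_derivative_const[of c] has_derivative_scaleR[OF 2 1]]
    show ?thesis by (simp add: P_def[abs_def] P'_def[abs_def])
  qed
  have P_det: "\<bar>det (matrix (P' x))\<bar> = \<bar>j (x $ 2) / 2\<bar>" if "x \<in> S" for x
  proof -
    define w where "w = \<gamma> (x $ 2) - c"
    have "sqrt (x $ 1) > 0" using that S by simp
    then have 1: "inverse (sqrt (x $ 1)) * sqrt (x $ 1) = 1" by simp
    have "det (matrix (P' x)) = inverse (sqrt (x $ 1)) * sqrt (x $ 1) *
        (\<rho> (x $ 2) * (w $ 1 * cos (x $ 2) + w $ 2 * sin (x $ 2))) / 2"
      by (simp add: det_2 matrix_def P'_def axis_def cos_add sin_add flip: w_def) (simp add: algebra_simps)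
    also have "\<dots> = j (x $ 2) / 2"
      unfolding 1 by (simp add: j_def support_def inner_real2 flip: w_def)
    finally show ?thesis by simp
  qed
  have P_inj: "inj_on P S"
  proof (rule inj_onI)
    fix x y assume xy: "x \<in> S" "y \<in> S" "P x = P y"
    \<comment> \<open>If the image of \<open>a\<close> equals that of \<open>b\<close>, comparing heights in the normal
      direction at the angle of \<open>a\<close> orders the two radii; the strict form of the support property gives equal
      angles when the radii agree.\<close>
    have le: "sqrt (a $ 1) \<le> sqrt (b $ 1) \<and> (sqrt (a $ 1) = sqrt (b $ 1) \<longrightarrow> unit_vec (a $ 2) = unit_vec (b $ 2))"
      if ab: "a \<in> S" "b \<in> S" "P a = P b" for a b
    proof -
      have pos: "sqrt (b $ 1) > 0" "support c (a $ 2) > 0" using ab S support_pos[OF c] by auto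
      have eq: "sqrt (a $ 1) * support c (a $ 2) = sqrt (b $ 1) * ((\<gamma> (b $ 2) - c) \<bullet> unit_vec (a $ 2))"
        using ab(3) unfolding P_def support_def by (metis add_left_cancel inner_scaleR_left)
      have le: "(\<gamma> (b $ 2) - c) \<bullet> unit_vec (a $ 2) \<le> support c (a $ 2)"
        using supported by (simp add: support_def inner_diff_left)
      have "sqrt (a $ 1) * support c (a $ 2) \<le> sqrt (b $ 1) * support c (a $ 2)"
        unfolding eq using le pos(1) by (intro mult_left_mono) auto
      then have 1: "sqrt (a $ 1) \<le> sqrt (b $ 1)" using pos(2) by simp
      have "unit_vec (b $ 2) = unit_vec (a $ 2)" if "sqrt (a $ 1) = sqrt (b $ 1)"
      proof (rule ccontr)
        assume "unit_vec (b $ 2) \<noteq> unit_vec (a $ 2)"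
        from strictly_supported[OF this] show False
          using eq pos that by (simp add: support_def inner_diff_left)
      qed
      then show ?thesis using 1 by simp
    qed
    from le[OF xy] le[OF xy(2,1) xy(3)[symmetric]]
    have 1: "x $ 1 = y $ 1" and u: "unit_vec (x $ 2) = unit_vec (y $ 2)" by auto
    have "cos (x $ 2 - y $ 2) = 1" using u by (metis inner_unit_vec diff_self cos_zero)
    then obtain n :: int where n: "x $ 2 - y $ 2 = of_int n * (2 * pi)"
      using cos_one_2pi_int by (metis mult.assoc)
    have "\<bar>x $ 2 - y $ 2\<bar> < 1 * (2 * pi)" using xy(1,2) by (auto simp: S)
    then have "\<bar>real_of_int n\<bar> < 1" unfolding n abs_mult by simp
    then have "n = 0" by linarith
    then show "x = y" using 1 n by (simp add: vec_eq_iff_2)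
  qed
  have P_image: "P ` S \<in> lmeasurable" "measure lebesgue (P ` S) = \<sigma> (2 * pi) / 2"
  proof -
    have "((\<lambda>x. \<bar>det (matrix (P' x))\<bar>) has_integral \<sigma> (2 * pi) / 2) S"
      by (rule has_integral_eq[OF _ half]) (use P_det in simp)
    then show "P ` S \<in> lmeasurable" "measure lebesgue (P ` S) = \<sigma> (2 * pi) / 2"
      using has_measure_differentiable_image[OF S_meas P_deriv P_inj] by blast+
  qed
  have P_inside: "P ` S \<subseteq> interior body"
  proof
    fix z assume "z \<in> P ` S"
    then obtain x where x: "x \<in> S" "z = P x" by blast
    have "(z - c) \<bullet> unit_vec \<alpha> < support c \<alpha>" for \<alpha>
    proof -
      have "(z - c) \<bullet> unit_vec \<alpha> = sqrt (x $ 1) * ((\<gamma> (x $ 2) - c) \<bullet> unit_vec \<alpha>)" by (simp add: x P_def)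
      also have "\<dots> \<le> sqrt (x $ 1) * support c \<alpha>"
        using supported x(1) S by (intro mult_left_mono) (auto simp: support_def inner_diff_left)
      also have "\<dots> < 1 * support c \<alpha>"
        using x(1) S support_pos[OF c] by (intro mult_strict_right_mono) auto
      finally show ?thesis by simp
    qed
    then show "z \<in> interior body" by (simp add: interior_body support_def inner_diff_left)
  qed
  \<comment> \<open>A normal vector of the line through \<open>c\<close> and \<open>\<gamma> 0\<close>; the image of the rectangle misses
    only points of this line.\<close>
  define a :: "real^2" where "a = vector [- (\<gamma> 0 - c) $ 2, (\<gamma> 0 - c) $ 1]"
  have "\<gamma> 0 - c \<noteq> 0" using support_pos[OF c, of 0] by (auto simp: support_def)
  then have "a \<noteq> 0" by (auto simp: a_def vec_eq_iff_2)
  have rest: "interior body - P ` S \<subseteq> {x. a \<bullet> x = a \<bullet> c}"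
  proof
    fix x assume x: "x \<in> interior body - P ` S"
    show "x \<in> {x. a \<bullet> x = a \<bullet> c}"
    proof (cases "x = c")
      case False
      then obtain r \<theta> where r: "0 < r" "r < 1" "0 \<le> \<theta>" "\<theta> < 2 * pi" "x = c + r *\<^sub>R (\<gamma> \<theta> - c)"
        using interior_body_polar[OF c] x by blast
      have "\<theta> = 0"
      proof (rule ccontr)
        assume "\<theta> \<noteq> 0"
        then have "vector [r\<^sup>2, \<theta>] \<in> S" using r by (simp add: S power_less_one_iff)
        moreover have "P (vector [r\<^sup>2, \<theta>]) = x" using r by (simp add: P_def)
        ultimately show False using x by blast
      qed
      then have "a \<bullet> x = a \<bullet> c + r * (a \<bullet> (\<gamma> 0 - c))"
        using r(5) by (simp only: inner_add_right inner_scaleR_right)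
      moreover have "a \<bullet> (\<gamma> 0 - c) = 0" by (simp add: a_def inner_real2 algebra_simps)
      ultimately show ?thesis by simp
    qed simp
  qed
  have "negligible (P ` S - interior body \<union> (interior body - P ` S))"
    by (rule negligible_subset[OF negligible_hyperplane[of a "a \<bullet> c"]]) (use \<open>a \<noteq> 0\<close> rest P_inside in auto)
  from measure_negligible_symdiff[OF P_image(1) this] P_image(2)
  show ?thesis by (simp add: \<sigma>_def j_def[abs_def])
qed

end

section \<open>The isoperimetric inequality for support functions\<close>

text \<open>For \<open>0 < l < 1\<close> and \<open>u x = l * (x - a - pi/2)\<close>, adding the derivative of
\<open>l * (f x)\<^sup>2 * tan (u x)\<close> to \<open>(f' x)\<^sup>2 - l\<^sup>2 * (f x)\<^sup>2\<close> completes the square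
\<open>(f' x + l * f x * tan (u x))\<^sup>2\<close>. The added term integrates to zero, because \<open>f\<close> vanishes at both ends.
The factor \<open>l < 1\<close> keeps the tangent bounded on the closed interval; the claim is the limit as
\<open>l\<close> tends to \<open>1\<close>.\<close>
theorem wirtinger_dirichlet:
  fixes f f' :: "real \<Rightarrow> real"
  assumes deriv: "\<And>x. x \<in> {a..a + pi} \<Longrightarrow> (f has_real_derivative f' x) (at x within {a..a + pi})"
    and cont: "continuous_on {a..a + pi} f'" and "f a = 0" "f (a + pi) = 0"
  shows "integral {a..a + pi} (\<lambda>x. (f x)\<^sup>2) \<le> integral {a..a + pi} (\<lambda>x. (f' x)\<^sup>2)"
proof -
  have contf: "continuous_on {a..a + pi} f"
    using deriv DERIV_continuous_on by blast
  have approx: "l\<^sup>2 * integral {a..a + pi} (\<lambda>x. (f x)\<^sup>2) \<le> integral {a..a + pi} (\<lambda>x. (f' x)\<^sup>2)"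
    if l: "0 < l" "l < 1" for l
  proof -
    define u where "u x = l * (x - a - pi / 2)" for x
    have cos_nz: "cos (u x) \<noteq> 0" if "x \<in> {a..a + pi}" for x
    proof -
      have "- (pi/2) \<le> x - a - pi/2" "x - a - pi/2 \<le> pi/2" using that by auto
      then have "\<bar>x - a - pi/2\<bar> \<le> pi/2" by linarith
      then have "\<bar>u x\<bar> \<le> l * (pi/2)" using l by (simp add: u_def abs_mult)
      also have "\<dots> < pi/2" using l by simp
      finally show ?thesis using cos_gt_zero_pi[of "u x"] by linarith
    qed
    let ?G' = "\<lambda>x. 2 * l * f x * f' x * tan (u x) + l\<^sup>2 * (f x)\<^sup>2 * (1 + (tan (u x))\<^sup>2)"
    have "((\<lambda>x. l * (f x)\<^sup>2 * tan (u x)) has_vector_derivative ?G' x) (at x within {a..a + pi})"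
      if "x \<in> {a..a + pi}" for x
    proof -
      have "inverse ((cos (u x))\<^sup>2) = 1 + (tan (u x))\<^sup>2"
        using tan_sec[OF cos_nz[OF that]] by (simp add: power_inverse)
      moreover have "(u has_real_derivative l) (at x within {a..a + pi})"
        unfolding u_def by (auto intro!: derivative_eq_intros)
      ultimately have "((\<lambda>x. tan (u x)) has_real_derivative (1 + (tan (u x))\<^sup>2) * l) (at x within {a..a + pi})"
        using DERIV_chain2[where f = tan and g = u, OF DERIV_tan[OF cos_nz[OF that]]] by simp
      from DERIV_mult[OF DERIV_cmult[OF DERIV_power[OF deriv[OF that], of 2], of l] this]
      show ?thesis
        unfolding has_real_derivative_iff_has_vector_derivative[symmetric]
        by (rule DERIV_cong) (simp add: algebra_simps power2_eq_square)
    qed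
    then have "(?G' has_integral (l * (f (a + pi))\<^sup>2 * tan (u (a + pi)) - l * (f a)\<^sup>2 * tan (u a))) {a..a + pi}"
      by (intro fundamental_theorem_of_calculus) auto
    then have 1: "(?G' has_integral 0) {a..a + pi}" using assms by simp
    have "((\<lambda>x. (f' x)\<^sup>2) has_integral integral {a..a + pi} (\<lambda>x. (f' x)\<^sup>2)) {a..a + pi}"
      "((\<lambda>x. (f x)\<^sup>2) has_integral integral {a..a + pi} (\<lambda>x. (f x)\<^sup>2)) {a..a + pi}"
      by (intro integrable_integral integrable_continuous_interval continuous_intros cont contf)+
    from has_integral_add[OF has_integral_diff[OF this(1) has_integral_mult_right[OF this(2), of "l\<^sup>2"]] 1]
    have "((\<lambda>x. (f' x + l * f x * tan (u x))\<^sup>2) has_integral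
        (integral {a..a + pi} (\<lambda>x. (f' x)\<^sup>2) - l\<^sup>2 * integral {a..a + pi} (\<lambda>x. (f x)\<^sup>2))) {a..a + pi}"
      by (rule has_integral_eq_rhs[OF has_integral_eq, rotated]) (auto simp: power2_eq_square algebra_simps)
    then have "0 \<le> integral {a..a + pi} (\<lambda>x. (f' x)\<^sup>2) - l\<^sup>2 * integral {a..a + pi} (\<lambda>x. (f x)\<^sup>2)"
      by (rule has_integral_nonneg) auto
    then show ?thesis by simp
  qed
  have "((\<lambda>l. l\<^sup>2 * integral {a..a + pi} (\<lambda>x. (f x)\<^sup>2)) \<longlongrightarrow> 1\<^sup>2 * integral {a..a + pi} (\<lambda>x. (f x)\<^sup>2)) (at_left 1)"
    by (intro tendsto_intros)
  moreover have "\<forall>\<^sub>F l in at_left (1::real). l\<^sup>2 * integral {a..a + pi} (\<lambda>x. (f x)\<^sup>2) \<le> integral {a..a + pi} (\<lambda>x. (f' x)\<^sup>2)"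
    using approx by (auto simp: eventually_at_left_field intro!: exI[of _ 0])
  ultimately show ?thesis
    using tendsto_upperbound[of _ _ "at_left (1::real)"] by fastforce
qed

text \<open>Integration by parts: \<open>p * r = p\<^sup>2 + p * p''\<close> with \<open>p'' = r - p\<close>.\<close>
lemma integral_support_times_radius:
  fixes p p\<^sub>1 r :: "real \<Rightarrow> real"
  assumes "a \<le> b" and p: "\<And>\<theta>. (p has_real_derivative p\<^sub>1 \<theta>) (at \<theta>)"
    and p1: "\<And>\<theta>. (p\<^sub>1 has_real_derivative r \<theta> - p \<theta>) (at \<theta>)"
    and ends: "p b * p\<^sub>1 b = p a * p\<^sub>1 a"
  shows "integral {a..b} (\<lambda>\<theta>. p \<theta> * r \<theta>) = integral {a..b} (\<lambda>\<theta>. (p \<theta>)\<^sup>2 - (p\<^sub>1 \<theta>)\<^sup>2)"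
proof -
  have c: "continuous_on {a..b} p" "continuous_on {a..b} p\<^sub>1"
    using p p1 by (meson DERIV_isCont continuous_at_imp_continuous_on)+
  have "((\<lambda>\<theta>. p\<^sub>1 \<theta> * p\<^sub>1 \<theta> + (r \<theta> - p \<theta>) * p \<theta>) has_integral (p b * p\<^sub>1 b - p a * p\<^sub>1 a)) {a..b}"
    using DERIV_mult[OF p p1] \<open>a \<le> b\<close>
    by (intro fundamental_theorem_of_calculus)
      (auto simp: has_real_derivative_iff_has_vector_derivative[symmetric] intro: has_field_derivative_at_within)
  then have 1: "((\<lambda>\<theta>. p\<^sub>1 \<theta> * p\<^sub>1 \<theta> + (r \<theta> - p \<theta>) * p \<theta>) has_integral 0) {a..b}" using ends by simp
  have 2: "((\<lambda>\<theta>. (p \<theta>)\<^sup>2 - (p\<^sub>1 \<theta>)\<^sup>2) has_integral integral {a..b} (\<lambda>\<theta>. (p \<theta>)\<^sup>2 - (p\<^sub>1 \<theta>)\<^sup>2)) {a..b}"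
    by (intro integrable_integral integrable_continuous_interval continuous_intros c)
  have "((\<lambda>\<theta>. p \<theta> * r \<theta>) has_integral 0 + integral {a..b} (\<lambda>\<theta>. (p \<theta>)\<^sup>2 - (p\<^sub>1 \<theta>)\<^sup>2)) {a..b}"
    by (rule has_integral_eq[OF _ has_integral_add[OF 1 2]]) (simp add: power2_eq_square algebra_simps)
  then show ?thesis by (simp add: integral_unique)
qed

text \<open>Periodicity is required of the squares only, so that the statement covers functions with
\<open>f (\<theta> + pi) = f \<theta>\<close> as well as those with \<open>f (\<theta> + pi) = - f \<theta>\<close>.\<close>
lemma wirtinger_half_period:
  fixes f f\<^sub>1 :: "real \<Rightarrow> real"
  assumes f: "\<And>\<theta>. (f has_real_derivative f\<^sub>1 \<theta>) (at \<theta>)" and cont: "continuous_on UNIV f\<^sub>1"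
    and zero: "f x = 0" "f (x + pi) = 0"
    and per: "\<And>\<theta>. (f (\<theta> + pi))\<^sup>2 = (f \<theta>)\<^sup>2" "\<And>\<theta>. (f\<^sub>1 (\<theta> + pi))\<^sup>2 = (f\<^sub>1 \<theta>)\<^sup>2"
  shows "integral {0..pi} (\<lambda>\<theta>. (f \<theta>)\<^sup>2) \<le> integral {0..pi} (\<lambda>\<theta>. (f\<^sub>1 \<theta>)\<^sup>2)"
proof -
  have cf: "continuous_on UNIV f" using f by (meson DERIV_isCont continuous_at_imp_continuous_on)
  have "integral {x..x + pi} (\<lambda>\<theta>. (f \<theta>)\<^sup>2) \<le> integral {x..x + pi} (\<lambda>\<theta>. (f\<^sub>1 \<theta>)\<^sup>2)"
    by (rule wirtinger_dirichlet)
      (use f zero continuous_on_subset[OF cont] in \<open>auto intro: has_field_derivative_at_within\<close>)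
  moreover have "integral {x..x + pi} (\<lambda>\<theta>. (f \<theta>)\<^sup>2) = integral {0..pi} (\<lambda>\<theta>. (f \<theta>)\<^sup>2)"
    by (rule integral_periodic_shift) (auto intro!: continuous_intros cf simp: per)
  moreover have "integral {x..x + pi} (\<lambda>\<theta>. (f\<^sub>1 \<theta>)\<^sup>2) = integral {0..pi} (\<lambda>\<theta>. (f\<^sub>1 \<theta>)\<^sup>2)"
    by (rule integral_periodic_shift) (auto intro!: continuous_intros cont simp: per)
  ultimately show ?thesis by simp
qed

text \<open>Wirtinger's inequality for \<open>e - e x\<close>, which vanishes at \<open>x\<close> and at \<open>x + pi\<close>. Completing the square
leaves the squared deviation of \<open>e x\<close> from the mean value as a lower bound; its availability for every \<open>x\<close>
settles the case of equality.\<close>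
lemma periodic_wirtinger_defect:
  fixes e e\<^sub>1 :: "real \<Rightarrow> real"
  assumes e: "\<And>\<theta>. (e has_real_derivative e\<^sub>1 \<theta>) (at \<theta>)" and cont: "continuous_on UNIV e\<^sub>1"
    and per: "\<And>\<theta>. e (\<theta> + pi) = e \<theta>" "\<And>\<theta>. e\<^sub>1 (\<theta> + pi) = e\<^sub>1 \<theta>"
  shows "pi * (e x - integral {0..pi} e / pi)\<^sup>2 \<le>
    (integral {0..pi} e)\<^sup>2 / pi + integral {0..pi} (\<lambda>\<theta>. (e\<^sub>1 \<theta>)\<^sup>2) - integral {0..pi} (\<lambda>\<theta>. (e \<theta>)\<^sup>2)"
proof -
  let ?M = "integral {0..pi} e"
  have ce: "continuous_on A e" for A using e by (meson DERIV_isCont continuous_at_imp_continuous_on)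
  have "integral {0..pi} (\<lambda>\<theta>. (e \<theta> - e x)\<^sup>2) \<le> integral {0..pi} (\<lambda>\<theta>. (e\<^sub>1 \<theta>)\<^sup>2)"
    by (rule wirtinger_half_period[of _ _ x]) (auto intro!: derivative_eq_intros e cont simp: per)
  moreover have "integral {0..pi} (\<lambda>\<theta>. (e \<theta> - e x)\<^sup>2)
      = integral {0..pi} (\<lambda>\<theta>. (e \<theta>)\<^sup>2) - 2 * e x * ?M + pi * (e x)\<^sup>2"
  proof (rule integral_unique)
    have "((\<lambda>\<theta>. (e \<theta>)\<^sup>2) has_integral integral {0..pi} (\<lambda>\<theta>. (e \<theta>)\<^sup>2)) {0..pi}" "(e has_integral ?M) {0..pi}"
      by (intro integrable_integral integrable_continuous_interval continuous_intros ce)+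
    from has_integral_add[OF has_integral_diff[OF this(1) has_integral_mult_right[OF this(2), of "2 * e x"]]
         has_integral_const_real[of "(e x)\<^sup>2" 0 pi]]
    have "((\<lambda>\<theta>. (e \<theta>)\<^sup>2 - 2 * e x * e \<theta> + (e x)\<^sup>2) has_integral
        (integral {0..pi} (\<lambda>\<theta>. (e \<theta>)\<^sup>2) - 2 * e x * ?M + pi * (e x)\<^sup>2)) {0..pi}" by simp
    then show "((\<lambda>\<theta>. (e \<theta> - e x)\<^sup>2) has_integral
        (integral {0..pi} (\<lambda>\<theta>. (e \<theta>)\<^sup>2) - 2 * e x * ?M + pi * (e x)\<^sup>2)) {0..pi}"
      by (rule has_integral_eq[rotated]) (simp add: power2_diff)
  qed
  moreover have "pi * (e x - ?M / pi)\<^sup>2 = pi * (e x)\<^sup>2 - 2 * e x * ?M + ?M\<^sup>2 / pi"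
    by (simp add: power2_diff power2_eq_square field_simps)
  ultimately show ?thesis by linarith
qed

text \<open>Here \<open>r\<close> is the radius of curvature, and \<open>L\<close>, \<open>A\<close> and \<open>W\<close> are the length, the enclosed area and
the oriented area of the Wigner caustic. With \<open>Q = integral (q'\<^sup>2 - q\<^sup>2)\<close> over a
half period, \<open>Q\<close> enters \<open>A\<close> as \<open>- Q\<close> and \<open>\<bar>W\<bar>\<close> as \<open>Q / 2\<close>, so it cancels in \<open>4 * pi * A + 8 * pi * \<bar>W\<bar>\<close>.\<close>
theorem isoperimetric_support:
  fixes p p\<^sub>1 r :: "real \<Rightarrow> real"
  assumes p: "\<And>\<theta>. (p has_real_derivative p\<^sub>1 \<theta>) (at \<theta>)"
    and p1: "\<And>\<theta>. (p\<^sub>1 has_real_derivative r \<theta> - p \<theta>) (at \<theta>)"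
    and cont_r: "continuous_on UNIV r"
    and per: "\<And>\<theta>. p (\<theta> + 2 * pi) = p \<theta>" "\<And>\<theta>. p\<^sub>1 (\<theta> + 2 * pi) = p\<^sub>1 \<theta>"
  defines "L \<equiv> integral {0..2 * pi} r" and "A \<equiv> integral {0..2 * pi} (\<lambda>\<theta>. p \<theta> * r \<theta>) / 2"
    and "W \<equiv> integral {0..pi} (\<lambda>\<theta>. (p \<theta> - p (\<theta> + pi)) / 2 * ((r \<theta> - r (\<theta> + pi)) / 2)) / 2"
  shows "4 * pi * A + 8 * pi * \<bar>W\<bar> \<le> L\<^sup>2"
    and "L\<^sup>2 = 4 * pi * A + 8 * pi * \<bar>W\<bar> \<longleftrightarrow> (\<exists>w. \<forall>\<theta>. p \<theta> + p (\<theta> + pi) = w)"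
proof -
  define e where "e \<theta> = (p \<theta> + p (\<theta> + pi)) / 2" for \<theta>
  define e\<^sub>1 where "e\<^sub>1 \<theta> = (p\<^sub>1 \<theta> + p\<^sub>1 (\<theta> + pi)) / 2" for \<theta>
  define q where "q \<theta> = (p \<theta> - p (\<theta> + pi)) / 2" for \<theta>
  define q\<^sub>1 where "q\<^sub>1 \<theta> = (p\<^sub>1 \<theta> - p\<^sub>1 (\<theta> + pi)) / 2" for \<theta>
  note shift = p[of "_ + pi", unfolded DERIV_shift] p1[of "_ + pi", unfolded DERIV_shift]
  have e: "(e has_real_derivative e\<^sub>1 \<theta>) (at \<theta>)" and q: "(q has_real_derivative q\<^sub>1 \<theta>) (at \<theta>)"
    and q1: "(q\<^sub>1 has_real_derivative (r \<theta> - r (\<theta> + pi)) / 2 - q \<theta>) (at \<theta>)" for \<theta>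
    unfolding e_def e\<^sub>1_def q_def q\<^sub>1_def
    by (auto intro!: derivative_eq_intros p p1 shift simp: field_simps)
  have cp: "continuous_on B p" "continuous_on B p\<^sub>1" for B
    using p p1 by (meson DERIV_isCont continuous_at_imp_continuous_on)+
  have cpi: "continuous_on B (\<lambda>\<theta>. p (\<theta> + pi))" "continuous_on B (\<lambda>\<theta>. p\<^sub>1 (\<theta> + pi))" for B
    using shift by (meson DERIV_isCont continuous_at_imp_continuous_on)+
  have c: "continuous_on B e" "continuous_on B e\<^sub>1" "continuous_on B q" "continuous_on B q\<^sub>1" for B
    unfolding e_def e\<^sub>1_def q_def q\<^sub>1_def by (auto intro!: continuous_intros cp cpi)
  have sh: "p (\<theta> + pi + pi) = p \<theta>" "p\<^sub>1 (\<theta> + pi + pi) = p\<^sub>1 \<theta>" for \<theta>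
    using per[of \<theta>] by (simp_all add: add.assoc)
  have e_per: "e (\<theta> + pi) = e \<theta>" "e\<^sub>1 (\<theta> + pi) = e\<^sub>1 \<theta>"
    and q_anti: "q (\<theta> + pi) = - q \<theta>" "q\<^sub>1 (\<theta> + pi) = - q\<^sub>1 \<theta>" for \<theta>
    unfolding e_def e\<^sub>1_def q_def q\<^sub>1_def by (simp_all only: sh) (simp_all add: field_simps)
  define M E Q where "M = integral {0..pi} e"
    and "E = integral {0..pi} (\<lambda>\<theta>. (e\<^sub>1 \<theta>)\<^sup>2) - integral {0..pi} (\<lambda>\<theta>. (e \<theta>)\<^sup>2)"
    and "Q = integral {0..pi} (\<lambda>\<theta>. (q\<^sub>1 \<theta>)\<^sup>2) - integral {0..pi} (\<lambda>\<theta>. (q \<theta>)\<^sup>2)"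
  have int: "(\<lambda>\<theta>. (e \<theta>)\<^sup>2) integrable_on {0..pi}" "(\<lambda>\<theta>. (e\<^sub>1 \<theta>)\<^sup>2) integrable_on {0..pi}"
    "(\<lambda>\<theta>. (q \<theta>)\<^sup>2) integrable_on {0..pi}" "(\<lambda>\<theta>. (q\<^sub>1 \<theta>)\<^sup>2) integrable_on {0..pi}"
    by (intro integrable_continuous_interval continuous_intros c)+
  have L: "L = 2 * M"
  proof -
    have "((\<lambda>\<theta>. r \<theta> - p \<theta>) has_integral (p\<^sub>1 (2 * pi) - p\<^sub>1 0)) {0..2 * pi}"
      using p1 by (intro fundamental_theorem_of_calculus)
        (auto simp: has_real_derivative_iff_has_vector_derivative[symmetric] intro: has_field_derivative_at_within)
    moreover have "p\<^sub>1 (2 * pi) = p\<^sub>1 0" using per(2)[of 0] by simp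
    ultimately have "integral {0..2 * pi} (\<lambda>\<theta>. r \<theta> - p \<theta>) = 0" by (simp add: integral_unique)
    moreover have "integral {0..2 * pi} (\<lambda>\<theta>. r \<theta> - p \<theta>) = L - integral {0..2 * pi} p"
      unfolding L_def by (intro integral_diff integrable_continuous_interval cp continuous_on_subset[OF cont_r]) auto
    moreover have "integral {0..2 * pi} p = 2 * M"
    proof -
      have e2: "e \<theta> = (1/2) * (p \<theta> + p (\<theta> + pi))" for \<theta> by (simp add: e_def)
      show ?thesis unfolding M_def e2 integral_mult_right integral_two_periods[OF cp(1) pi_ge_zero] by simp
    qed
    ultimately show ?thesis by simp
  qed
  have A: "A = - E - Q"
  proof -
    have "2 * A = integral {0..2 * pi} (\<lambda>\<theta>. (p \<theta>)\<^sup>2 - (p\<^sub>1 \<theta>)\<^sup>2)"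
      unfolding A_def using per[of 0] by (subst integral_support_times_radius[OF _ p p1]) auto
    also have "\<dots> = integral {0..pi} (\<lambda>\<theta>. (p \<theta>)\<^sup>2 - (p\<^sub>1 \<theta>)\<^sup>2 + ((p (\<theta> + pi))\<^sup>2 - (p\<^sub>1 (\<theta> + pi))\<^sup>2))"
      by (intro integral_two_periods continuous_intros cp) simp
    also have "\<dots> = integral {0..pi} (\<lambda>\<theta>. 2 * (((e \<theta>)\<^sup>2 - (e\<^sub>1 \<theta>)\<^sup>2) + ((q \<theta>)\<^sup>2 - (q\<^sub>1 \<theta>)\<^sup>2)))"
    proof -
      have "(p \<theta>)\<^sup>2 - (p\<^sub>1 \<theta>)\<^sup>2 + ((p (\<theta> + pi))\<^sup>2 - (p\<^sub>1 (\<theta> + pi))\<^sup>2)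
          = 2 * (((e \<theta>)\<^sup>2 - (e\<^sub>1 \<theta>)\<^sup>2) + ((q \<theta>)\<^sup>2 - (q\<^sub>1 \<theta>)\<^sup>2))" for \<theta>
        by (simp add: e_def e\<^sub>1_def q_def q\<^sub>1_def power2_eq_square field_simps)
      then show ?thesis by simp
    qed
    also have "\<dots> = 2 * (- E - Q)"
      by (simp add: E_def Q_def int integral_add integral_diff integrable_diff)
    finally show ?thesis by simp
  qed
  have W: "W = - Q / 2"
  proof -
    have "2 * W = integral {0..pi} (\<lambda>\<theta>. q \<theta> * ((r \<theta> - r (\<theta> + pi)) / 2))"
      by (simp add: W_def q_def)
    also have "\<dots> = integral {0..pi} (\<lambda>\<theta>. (q \<theta>)\<^sup>2 - (q\<^sub>1 \<theta>)\<^sup>2)"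
      using q_anti[of 0] by (intro integral_support_times_radius q q1) auto
    also have "\<dots> = - Q" by (simp add: Q_def int integral_diff)
    finally show ?thesis by simp
  qed
  have "Q \<ge> 0"
  proof -
    have "\<exists>x. q x = 0"
    proof (cases "q 0 \<le> 0")
      case True
      then show ?thesis using IVT'[of q 0 0 pi] c(3) q_anti(1)[of 0] by auto
    next
      case False
      then show ?thesis using IVT2'[of q pi 0 0] c(3) q_anti(1)[of 0] by auto
    qed
    then obtain x where "q x = 0" by blast
    then have "integral {0..pi} (\<lambda>\<theta>. (q \<theta>)\<^sup>2) \<le> integral {0..pi} (\<lambda>\<theta>. (q\<^sub>1 \<theta>)\<^sup>2)"
      by (intro wirtinger_half_period[OF q c(4), of x]) (auto simp: q_anti)
    then show ?thesis by (simp add: Q_def)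
  qed
  then have "\<bar>W\<bar> = Q / 2" by (simp add: W)
  then have "L\<^sup>2 - (4 * pi * A + 8 * pi * \<bar>W\<bar>) = 4 * pi * (M\<^sup>2 / pi + E)"
    by (simp add: L A power2_eq_square field_simps)
  moreover have defect: "pi * (e x - M / pi)\<^sup>2 \<le> M\<^sup>2 / pi + E" for x
    using periodic_wirtinger_defect[OF e c(2) e_per, of x] by (simp add: M_def E_def)
  moreover have "0 \<le> pi * (e 0 - M / pi)\<^sup>2" by simp
  ultimately show "4 * pi * A + 8 * pi * \<bar>W\<bar> \<le> L\<^sup>2"
    using defect[of 0] by (smt (verit, best) mult_nonneg_nonneg pi_ge_zero)
  have eq: "L\<^sup>2 = 4 * pi * A + 8 * pi * \<bar>W\<bar> \<longleftrightarrow> M\<^sup>2 / pi + E = 0"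
    using \<open>L\<^sup>2 - (4 * pi * A + 8 * pi * \<bar>W\<bar>) = 4 * pi * (M\<^sup>2 / pi + E)\<close> by (metis eq_iff_diff_eq_0 mult_eq_0_iff pi_neq_zero zero_neq_numeral)
  show "L\<^sup>2 = 4 * pi * A + 8 * pi * \<bar>W\<bar> \<longleftrightarrow> (\<exists>w. \<forall>\<theta>. p \<theta> + p (\<theta> + pi) = w)"
    unfolding eq
  proof
    assume "M\<^sup>2 / pi + E = 0"
    then have "pi * (e x - M / pi)\<^sup>2 \<le> 0" for x using defect[of x] by simp
    then have "e x = M / pi" for x using pi_gt_zero by (simp add: mult_le_0_iff not_le[symmetric] del: pi_gt_zero)
    then have "p \<theta> + p (\<theta> + pi) = 2 * (M / pi)" for \<theta> unfolding e_def by (metis nonzero_mult_div_cancel_left times_divide_eq_right zero_neq_numeral)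
    then show "\<exists>w. \<forall>\<theta>. p \<theta> + p (\<theta> + pi) = w" by blast
  next
    assume "\<exists>w. \<forall>\<theta>. p \<theta> + p (\<theta> + pi) = w"
    then obtain w where "\<forall>\<theta>. p \<theta> + p (\<theta> + pi) = w" by blast
    then have w: "e \<theta> = w / 2" for \<theta> by (simp add: e_def)
    have "e = (\<lambda>_. w / 2)" using w by auto
    then have "e\<^sub>1 \<theta> = 0" for \<theta> using e[of \<theta>] DERIV_unique by (metis DERIV_const)
    then have "E = - (pi * (w / 2)\<^sup>2)" unfolding E_def by (simp add: \<open>e = (\<lambda>_. w / 2)\<close>)
    moreover have "M = pi * (w / 2)" unfolding M_def \<open>e = (\<lambda>_. w / 2)\<close> by simp
    ultimately show "M\<^sup>2 / pi + E = 0" by (simp only:) (simp add: power2_eq_square)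
  qed
qed

section \<open>Length, Wigner caustic and width in terms of the support function\<close>

lemma setdist_parallel_lines:
  fixes n :: "'a::euclidean_space"
  assumes n: "norm n = 1"
  shows "setdist {x. x \<bullet> n = a} {x. x \<bullet> n = b} = \<bar>a - b\<bar>"
proof (rule antisym)
  have nn: "n \<bullet> n = 1" using n by (simp add: dot_square_norm)
  have "a *\<^sub>R n \<in> {x. x \<bullet> n = a}" "b *\<^sub>R n \<in> {x. x \<bullet> n = b}" by (simp_all add: nn)
  note mem = this
  have "dist (a *\<^sub>R n) (b *\<^sub>R n) = \<bar>a - b\<bar>"
    using n by (simp add: dist_norm flip: scaleR_diff_left)
  then show "setdist {x. x \<bullet> n = a} {x. x \<bullet> n = b} \<le> \<bar>a - b\<bar>"
    using setdist_le_dist[OF mem] by metis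
  show "\<bar>a - b\<bar> \<le> setdist {x. x \<bullet> n = a} {x. x \<bullet> n = b}"
  proof (rule le_setdistI)
    fix x y assume "x \<in> {x. x \<bullet> n = a}" "y \<in> {x. x \<bullet> n = b}"
    then have "a - b = (x - y) \<bullet> n" by (simp add: inner_diff_left)
    then show "\<bar>a - b\<bar> \<le> dist x y"
      using Cauchy_Schwarz_ineq2[of "x - y" n] n by (simp add: dist_norm)
  next
    show "{x. x \<bullet> n = a} \<noteq> {}" "{x. x \<bullet> n = b} \<noteq> {}" using mem by blast+
  qed
qed

context support_curve
begin

definition support\<^sub>1 :: "real^2 \<Rightarrow> real \<Rightarrow> real" where
  "support\<^sub>1 c \<theta> = (\<gamma> \<theta> - c) \<bullet> unit_vec (\<theta> + pi/2)"

lemma support_deriv: "(support c has_real_derivative support\<^sub>1 c \<theta>) (at \<theta>)"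
  using inner_derivative[OF has_vector_derivative_unit_vec, where c = c]
  by (simp add: support_def[abs_def] support\<^sub>1_def inner_unit_vec)

lemma support\<^sub>1_deriv: "(support\<^sub>1 c has_real_derivative \<rho> \<theta> - support c \<theta>) (at \<theta>)"
proof -
  have "((\<lambda>\<theta>. \<theta> + pi/2) has_vector_derivative 1) (at \<theta>)" by (auto intro!: derivative_eq_intros)
  from vector_diff_chain_at[OF this has_vector_derivative_unit_vec]
  have "((\<lambda>\<theta>. unit_vec (\<theta> + pi/2)) has_vector_derivative unit_vec (\<theta> + pi/2 + pi/2)) (at \<theta>)"
    by (simp add: o_def)
  moreover have "unit_vec (\<theta> + pi/2 + pi/2) = - unit_vec \<theta>"
    using unit_vec_add_pi[of \<theta>] by (simp add: add.assoc)
  ultimately have "((\<lambda>\<theta>. unit_vec (\<theta> + pi/2)) has_vector_derivative - unit_vec \<theta>) (at \<theta>)" by simp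
  from inner_derivative[OF this, where c = c] show ?thesis
    by (simp add: support\<^sub>1_def[abs_def] support_def inner_unit_vec)
qed

lemma support_periodic: "support c (\<theta> + 2 * pi) = support c \<theta>"
  "support\<^sub>1 c (\<theta> + 2 * pi) = support\<^sub>1 c \<theta>"
proof -
  have "\<theta> + 2 * pi + pi/2 = \<theta> + pi/2 + 2 * pi" by simp
  then show "support c (\<theta> + 2 * pi) = support c \<theta>" "support\<^sub>1 c (\<theta> + 2 * pi) = support\<^sub>1 c \<theta>"
    by (simp_all only: support_def support\<^sub>1_def periodic unit_vec_add_2pi)
qed

lemma support_width: "support c \<theta> + support c (\<theta> + pi) = \<gamma> \<theta> \<bullet> unit_vec \<theta> - \<gamma> (\<theta> + pi) \<bullet> unit_vec \<theta>"
  by (simp add: support_def unit_vec_add_pi inner_diff_left)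

lemma width_pos: "\<gamma> (\<theta> + pi) \<bullet> unit_vec \<theta> < \<gamma> \<theta> \<bullet> unit_vec \<theta>"
proof (rule strictly_supported)
  show "unit_vec (\<theta> + pi) \<noteq> unit_vec \<theta>"
    by (metis inner_unit_vec cos_pi cos_zero add_diff_cancel_left' diff_self one_neq_neg_one)
qed

lemma minus_unit_vec_imp:
  assumes "unit_vec \<alpha> = - unit_vec \<theta>" shows "\<gamma> \<alpha> = \<gamma> (\<theta> + pi)"
  using assms by (intro unit_vec_eq_imp) (simp add: unit_vec_add_pi)

end

context normal_angle_curve
begin

lemma velocity_g: "velocity g t = (\<nu>' t * \<rho> (\<nu> t)) *\<^sub>R unit_vec (\<nu> t + pi/2)"
proof -
  have "g = \<gamma> \<circ> \<nu>" using g_eq by auto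
  then show ?thesis
    using vector_derivative_at[OF vector_diff_chain_at[OF nu_deriv[unfolded has_real_derivative_iff_has_vector_derivative] deriv]]
    by simp
qed

lemma velocity_coeff_nz: "\<nu>' t * \<rho> (\<nu> t) \<noteq> 0"
  using nu'_sign[of t] rho_pos[of "\<nu> t"] by auto

lemma range_g: "range g = range \<gamma>"
proof -
  have "g = \<gamma> \<circ> \<nu>" using g_eq by auto
  then show ?thesis using nu_surj by (metis image_comp)
qed

lemma outer_normal_iff: "outer_normal g t n \<longleftrightarrow> n = unit_vec (\<nu> t)"
proof -
  have "n \<bullet> velocity g t = 0 \<longleftrightarrow> n \<bullet> unit_vec (\<nu> t + pi/2) = 0"
    using velocity_coeff_nz[of t] by (simp add: velocity_g)
  moreover have "unit_vec (\<nu> t) \<bullet> unit_vec (\<nu> t + pi/2) = 0" by (simp add: inner_unit_vec)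
  ultimately show ?thesis
    unfolding outer_normal_def range_g g_eq using outward_iff[of n "\<nu> t"] by auto
qed

lemma support_fun_eq: "support_fun g c = support c"
proof
  fix \<theta>
  show "support_fun g c \<theta> = support c \<theta>"
    unfolding support_fun_def outer_normal_iff
  proof (rule the_equality)
    obtain t where "\<nu> t = \<theta>" using nu_surj by (metis surjD)
    then show "\<exists>t. unit_vec \<theta> = unit_vec (\<nu> t) \<and> support c \<theta> = (g t - c) \<bullet> unit_vec \<theta>"
      by (auto simp: g_eq support_def)
  next
    fix d assume "\<exists>t. unit_vec \<theta> = unit_vec (\<nu> t) \<and> d = (g t - c) \<bullet> unit_vec \<theta>"
    then obtain t where t: "unit_vec \<theta> = unit_vec (\<nu> t)" "d = (g t - c) \<bullet> unit_vec \<theta>" by blast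
    show "d = support c \<theta>" using unit_vec_eq_imp[OF t(1)] t(2) by (simp add: g_eq support_def)
  qed
qed

lemma support_param_eq: "support_param g c \<theta> = \<gamma> \<theta> - c"
proof -
  have "support_param g c \<theta> = support c \<theta> *\<^sub>R unit_vec \<theta> + support\<^sub>1 c \<theta> *\<^sub>R unit_vec (\<theta> + pi/2)"
    unfolding support_param_def support_fun_eq Let_def DERIV_imp_deriv[OF support_deriv]
    by (simp add: vec_eq_iff_2 cos_add sin_add)
  also have "\<dots> = \<gamma> \<theta> - c" unfolding support_def support\<^sub>1_def by (rule unit_vec_expansion[symmetric])
  finally show ?thesis .
qed

text \<open>The velocity of the caustic at \<open>\<theta>\<close> is orthogonal to \<open>unit_vec \<theta>\<close>, because the tangents at
both end points of the chord are. So the integrand is the support function of the caustic times its signed radius of curvature.\<close>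
lemma wigner_oriented_area_eq:
  "wigner_oriented_area g c = integral {0..pi} (\<lambda>\<theta>. (support c \<theta> - support c (\<theta> + pi)) / 2 *
      ((\<rho> \<theta> - \<rho> (\<theta> + pi)) / 2)) / 2"
proof -
  let ?w = "wigner_caustic g c"
  have w: "?w = (\<lambda>\<theta>. (1/2) *\<^sub>R (\<gamma> \<theta> - c) + (1/2) *\<^sub>R (\<gamma> (\<theta> + pi) - c))"
    by (rule ext) (simp add: wigner_caustic_def support_param_eq)
  have v: "velocity ?w \<theta> = ((\<rho> \<theta> - \<rho> (\<theta> + pi)) / 2) *\<^sub>R unit_vec (\<theta> + pi/2)" for \<theta>
  proof (rule vector_derivative_at)
    have "((\<lambda>\<theta>. \<theta> + pi) has_vector_derivative 1) (at \<theta>)" by (auto intro!: derivative_eq_intros)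
    from vector_diff_chain_at[OF this deriv]
    have "((\<lambda>\<theta>. \<gamma> (\<theta> + pi)) has_vector_derivative \<rho> (\<theta> + pi) *\<^sub>R unit_vec (\<theta> + pi + pi/2)) (at \<theta>)"
      by (simp add: o_def)
    moreover have "unit_vec (\<theta> + pi + pi/2) = - unit_vec (\<theta> + pi/2)"
      using unit_vec_add_pi[of "\<theta> + pi/2"] by (simp add: add_ac)
    ultimately have d: "((\<lambda>\<theta>. \<gamma> (\<theta> + pi)) has_vector_derivative - (\<rho> (\<theta> + pi) *\<^sub>R unit_vec (\<theta> + pi/2))) (at \<theta>)"
      by simp
    have "(?w has_vector_derivative (1/2) *\<^sub>R (\<rho> \<theta> *\<^sub>R unit_vec (\<theta> + pi/2) - 0)
        + (1/2) *\<^sub>R (- (\<rho> (\<theta> + pi) *\<^sub>R unit_vec (\<theta> + pi/2)) - 0)) (at \<theta>)"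
      unfolding w
      by (intro has_vector_derivative_add has_vector_derivative_diff has_vector_derivative_const
          bounded_linear.has_vector_derivative[OF bounded_linear_scaleR_right] d deriv)
    then show "(?w has_vector_derivative ((\<rho> \<theta> - \<rho> (\<theta> + pi)) / 2) *\<^sub>R unit_vec (\<theta> + pi/2)) (at \<theta>)"
      by (simp add: diff_divide_distrib scaleR_diff_left)
  qed
  have integrand: "?w \<theta> $ 1 * velocity ?w \<theta> $ 2 - ?w \<theta> $ 2 * velocity ?w \<theta> $ 1
      = (support c \<theta> - support c (\<theta> + pi)) / 2 * ((\<rho> \<theta> - \<rho> (\<theta> + pi)) / 2)" for \<theta>
  proof -
    have "?w \<theta> $ 1 * velocity ?w \<theta> $ 2 - ?w \<theta> $ 2 * velocity ?w \<theta> $ 1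
        = (?w \<theta> \<bullet> unit_vec \<theta>) * ((\<rho> \<theta> - \<rho> (\<theta> + pi)) / 2)"
      unfolding v by (simp add: inner_real2 cos_add sin_add) (simp add: algebra_simps)
    also have "?w \<theta> \<bullet> unit_vec \<theta> = (support c \<theta> - support c (\<theta> + pi)) / 2"
      unfolding w by (simp add: support_def unit_vec_add_pi inner_add_left)
    finally show ?thesis .
  qed
  show ?thesis unfolding wigner_oriented_area_def Let_def integrand by simp
qed

lemma curve_length_eq: "curve_length g T = integral {0..2 * pi} \<rho>"
proof -
  have cont_nu: "continuous_on {0..T} \<nu>"
    using nu_deriv by (meson DERIV_isCont continuous_at_imp_continuous_on)
  then have "bounded (\<nu> ` {0..T})" by (intro compact_imp_bounded compact_continuous_image) auto
  then obtain B where B: "\<nu> ` {0..T} \<subseteq> {- B..B}"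
    using bounded_subset_cbox_symmetric by (metis cbox_interval)
  have "((\<lambda>t. \<nu>' t *\<^sub>R \<rho> (\<nu> t)) has_integral (integral {\<nu> 0..\<nu> T} \<rho> - integral {\<nu> T..\<nu> 0} \<rho>)) {0..T}"
    by (rule has_integral_substitution_general[of "{}", OF _ _ B])
      (use T_pos cont_nu continuous_on_subset[OF cont_rho] in
        \<open>auto intro: has_field_derivative_at_within nu_deriv\<close>)
  from has_integral_mult_right[OF this, of \<sigma>]
  have "((\<lambda>t. norm (velocity g t)) has_integral \<sigma> * (integral {\<nu> 0..\<nu> T} \<rho> - integral {\<nu> T..\<nu> 0} \<rho>)) {0..T}"
  proof (rule has_integral_eq[rotated])
    fix t
    have "\<bar>\<nu>' t\<bar> = \<sigma> * \<nu>' t" using sign nu'_sign[of t] by auto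
    then show "\<sigma> * (\<nu>' t *\<^sub>R \<rho> (\<nu> t)) = norm (velocity g t)"
      using rho_pos[of "\<nu> t"] by (simp add: velocity_g abs_mult)
  qed
  then have "curve_length g T = \<sigma> * (integral {\<nu> 0..\<nu> T} \<rho> - integral {\<nu> T..\<nu> 0} \<rho>)"
    by (simp add: curve_length_def integral_unique)
  moreover have turn: "integral {a..a + 2 * pi} \<rho> = integral {0..2 * pi} \<rho>" for a
    by (rule integral_periodic_shift[OF cont_rho rho_periodic]) simp
  moreover have end_angle: "\<nu> T = \<nu> 0 + \<sigma> * (2 * pi)" using nu_turn[of 0] by simp
  ultimately show ?thesis
    using sign turn[of "\<nu> 0"] turn[of "\<nu> T"] by (elim disjE) simp_all
qed

lemma tangent_line_eq: "tangent_line g t = {x. x \<bullet> unit_vec (\<nu> t) = \<gamma> (\<nu> t) \<bullet> unit_vec (\<nu> t)}"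
proof (intro equalityI subsetI)
  fix x assume "x \<in> tangent_line g t"
  then show "x \<in> {x. x \<bullet> unit_vec (\<nu> t) = \<gamma> (\<nu> t) \<bullet> unit_vec (\<nu> t)}"
    by (auto simp: tangent_line_def velocity_g g_eq inner_add_left inner_unit_vec)
next
  fix x assume "x \<in> {x. x \<bullet> unit_vec (\<nu> t) = \<gamma> (\<nu> t) \<bullet> unit_vec (\<nu> t)}"
  then have "(x - \<gamma> (\<nu> t)) \<bullet> unit_vec (\<nu> t) = 0" by (simp add: inner_diff_left)
  then have "x - \<gamma> (\<nu> t) = ((x - \<gamma> (\<nu> t)) \<bullet> unit_vec (\<nu> t + pi/2)) *\<^sub>R unit_vec (\<nu> t + pi/2)" (is "_ = ?k *\<^sub>R _")
    using unit_vec_expansion[of "x - \<gamma> (\<nu> t)" "\<nu> t"] by simp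
  then have "x = \<gamma> (\<nu> t) + ?k *\<^sub>R unit_vec (\<nu> t + pi/2)" by (metis add.commute diff_add_cancel)
  then have "x = g t + (?k / (\<nu>' t * \<rho> (\<nu> t))) *\<^sub>R velocity g t"
    using velocity_coeff_nz[of t] by (simp add: g_eq velocity_g)
  then show "x \<in> tangent_line g t" by (auto simp: tangent_line_def)
qed

lemma parallel_tangents_iff:
  "parallel_tangents g s t \<longleftrightarrow> unit_vec (\<nu> t) = unit_vec (\<nu> s) \<or> unit_vec (\<nu> t) = - unit_vec (\<nu> s)"
proof -
  let ?u = "\<lambda>t. unit_vec (\<nu> t + pi/2)"
  have rot: "?u t = k *\<^sub>R ?u s \<longleftrightarrow> unit_vec (\<nu> t) = k *\<^sub>R unit_vec (\<nu> s)" for k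
    by (auto simp: vec_eq_iff_2 cos_add sin_add)
  show ?thesis
  proof
    assume "parallel_tangents g s t"
    then obtain k where "velocity g t = k *\<^sub>R velocity g s" by (auto simp: parallel_tangents_def)
    then have "(\<nu>' t * \<rho> (\<nu> t)) *\<^sub>R ?u t = (k * (\<nu>' s * \<rho> (\<nu> s))) *\<^sub>R ?u s" by (simp add: velocity_g)
    then have "(1 / (\<nu>' t * \<rho> (\<nu> t))) *\<^sub>R (\<nu>' t * \<rho> (\<nu> t)) *\<^sub>R ?u t =
        (1 / (\<nu>' t * \<rho> (\<nu> t))) *\<^sub>R (k * (\<nu>' s * \<rho> (\<nu> s))) *\<^sub>R ?u s" by (rule arg_cong)
    then have "?u t = (k * (\<nu>' s * \<rho> (\<nu> s)) / (\<nu>' t * \<rho> (\<nu> t))) *\<^sub>R ?u s"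
      using velocity_coeff_nz[of t] by simp
    then obtain l where l: "?u t = l *\<^sub>R ?u s" by blast
    from arg_cong[OF l, of norm] have "\<bar>l\<bar> = 1" by simp
    then have "l = 1 \<or> l = -1" by linarith
    then show "unit_vec (\<nu> t) = unit_vec (\<nu> s) \<or> unit_vec (\<nu> t) = - unit_vec (\<nu> s)"
      using rot[of l] l by auto
  next
    assume "unit_vec (\<nu> t) = unit_vec (\<nu> s) \<or> unit_vec (\<nu> t) = - unit_vec (\<nu> s)"
    then have "?u t = 1 *\<^sub>R ?u s \<or> ?u t = (-1) *\<^sub>R ?u s" unfolding rot by simp
    then obtain l where "?u t = l *\<^sub>R ?u s" by blast
    then have "velocity g t = ((\<nu>' t * \<rho> (\<nu> t)) * l / (\<nu>' s * \<rho> (\<nu> s))) *\<^sub>R velocity g s"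
      using velocity_coeff_nz[of s] by (simp add: velocity_g)
    then show "parallel_tangents g s t" by (auto simp: parallel_tangents_def)
  qed
qed

lemma opposite_tangent_lines:
  assumes "unit_vec (\<nu> t) = - unit_vec (\<nu> s)"
  shows "tangent_line g s \<noteq> tangent_line g t"
    and "setdist (tangent_line g s) (tangent_line g t) = support c (\<nu> s) + support c (\<nu> s + pi)"
proof -
  have gt: "\<gamma> (\<nu> t) = \<gamma> (\<nu> s + pi)" using minus_unit_vec_imp assms .
  have lt: "tangent_line g t = {x. x \<bullet> unit_vec (\<nu> s) = \<gamma> (\<nu> s + pi) \<bullet> unit_vec (\<nu> s)}"
    by (simp add: tangent_line_eq assms gt)
  have "\<gamma> (\<nu> s) \<in> tangent_line g s" by (simp add: tangent_line_eq)
  moreover have "\<gamma> (\<nu> s) \<notin> tangent_line g t" using width_pos[of "\<nu> s"] by (simp add: lt)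
  ultimately show "tangent_line g s \<noteq> tangent_line g t" by blast
  show "setdist (tangent_line g s) (tangent_line g t) = support c (\<nu> s) + support c (\<nu> s + pi)"
    unfolding lt tangent_line_eq[of s] setdist_parallel_lines[OF norm_unit_vec] support_width
    using width_pos[of "\<nu> s"] by simp
qed

text \<open>Distinct parallel tangent lines are those with opposite normals, and their distance is the width
\<open>support c \<theta> + support c (\<theta> + pi)\<close>.\<close>
theorem constant_width_iff:
  "constant_width g \<longleftrightarrow> (\<exists>w. \<forall>\<theta>. support c \<theta> + support c (\<theta> + pi) = w)"
proof
  assume "constant_width g"
  then obtain w where w: "\<And>s t. parallel_tangents g s t \<Longrightarrow> tangent_line g s \<noteq> tangent_line g t
      \<Longrightarrow> setdist (tangent_line g s) (tangent_line g t) = w" by (auto simp: constant_width_def)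
  have "support c \<theta> + support c (\<theta> + pi) = w" for \<theta>
  proof -
    obtain s t where st: "\<nu> s = \<theta>" "\<nu> t = \<theta> + pi" using nu_surj by (metis surjD)
    then have opp: "unit_vec (\<nu> t) = - unit_vec (\<nu> s)" by (simp add: unit_vec_add_pi)
    then have "parallel_tangents g s t" by (simp add: parallel_tangents_iff)
    from w[OF this opposite_tangent_lines(1)[OF opp]] opposite_tangent_lines(2)[OF opp, of c] st
    show ?thesis by simp
  qed
  then show "\<exists>w. \<forall>\<theta>. support c \<theta> + support c (\<theta> + pi) = w" by blast
next
  assume "\<exists>w. \<forall>\<theta>. support c \<theta> + support c (\<theta> + pi) = w"
  then obtain w where w: "\<And>\<theta>. support c \<theta> + support c (\<theta> + pi) = w" by blast
  have "setdist (tangent_line g s) (tangent_line g t) = w"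
    if "parallel_tangents g s t" "tangent_line g s \<noteq> tangent_line g t" for s t
  proof -
    have "unit_vec (\<nu> t) \<noteq> unit_vec (\<nu> s)"
      using that(2) unit_vec_eq_imp[of "\<nu> t" "\<nu> s"] by (auto simp: tangent_line_eq)
    then have "unit_vec (\<nu> t) = - unit_vec (\<nu> s)" using that(1) by (simp add: parallel_tangents_iff)
    then show ?thesis using opposite_tangent_lines(2)[of t s c] w by simp
  qed
  then show "constant_width g" unfolding constant_width_def by (intro exI[of _ w]) simp
qed

end

section \<open>The improved isoperimetric inequality\<close>

theorem theorem3p4:
  fixes g :: "real \<Rightarrow> real^2" and T :: real and c :: "real^2"
  assumes "oval g T"
    and "c \<in> inside (range g)"
  shows "(curve_length g T)\<^sup>2 \<ge> 4 * pi * enclosed_area g + 8 * pi * \<bar>wigner_oriented_area g c\<bar>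
    \<and> ((curve_length g T)\<^sup>2 = 4 * pi * enclosed_area g + 8 * pi * \<bar>wigner_oriented_area g c\<bar>
         \<longleftrightarrow> constant_width g)"
proof -
  obtain \<gamma> \<rho> \<nu> \<nu>' \<sigma> where "normal_angle_curve \<gamma> \<rho> g T \<nu> \<nu>' \<sigma>"
    using oval_by_normal_angle[OF assms(1)] .
  then interpret normal_angle_curve \<gamma> \<rho> g T \<nu> \<nu>' \<sigma> .
  have "c \<in> interior body" using assms(2) by (simp add: range_g inside_range)
  then have area: "enclosed_area g = integral {0..2 * pi} (\<lambda>\<theta>. support c \<theta> * \<rho> \<theta>) / 2"
    unfolding enclosed_area_def range_g inside_range by (rule measure_interior_body)
  note iso = isoperimetric_support[OF support_deriv[of c] support\<^sub>1_deriv[of c] cont_rho support_periodic[of c],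
      folded curve_length_eq area wigner_oriented_area_eq constant_width_iff]
  show ?thesis using iso by blast
qed

end
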